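(* Let $G\in\mathcal{G}_n^{sc}$ be a self-converse mixed graph on vertex set $[n]$, let $A=A(G)$ be its Hermitian adjacency matrix and $W=[e,Ae,A^2e,\ldots,A^{n-1}e]$ its walk-matrix. If $\frac{\det W}{2^{\lfloor n/2\rfloor}}$ is square-free in $\mathbb{Z}[i]$, then for every $U\in\mathscr{U}_G$ the level satisfies $\ell(U)\in\{1,1+i\}$.
   Context: A mixed graph is obtained from a simple undirected graph by orienting a subset of its edges; $\mathcal{G}_n$ denotes the set of mixed graphs on vertex set $[n]=\{1,\ldots,n\}$. The Hermitian adjacency matrix $A(G)=(a_{u,v})$ has $a_{u,v}=1$ if $uv$ is an undirected edge, $a_{u,v}=i$ if there is a directed edge $u\to v$, $a_{u,v}=-i$ if there is a directed edge $v\to u$, and $0$ otherwise. The converse $G^{T}$ is obtained by reversing every directed edge (so $A(G^T)=A(G)^T$); $G$ is self-converse if $G^T$ is isomorphic to $G$, and $\mathcal{G}_n^{sc}\subseteq\mathcal{G}_n$ is the set of self-converse mixed graphs. $e$ denotes the all-one vector. A Gaussian integer $z$ is square-free if $p^2\nmid z$ in $\mathbb{Z}[i]$ for every Gaussian prime $p$ (in particular $0$ and multiples of $2=-i(1+i)^2$ are not square-free). A Gaussian rational matrix has entries with rational real and imaginary parts; $U$ is unitary if $U^*U=I$. Let $\Gamma=\{z\in\mathbb{Z}[i]:\mathrm{Re}(z)>0,\ \mathrm{Im}(z)\ge 0\}$. The level $\ell(U)$ of a Gaussian rational unitary matrix $U$ is the unique Gaussian integer $\ell\in\Gamma$ such that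 $\ell U$ has Gaussian integer entries and the norm $N(\ell)=|\ell|^2$ is minimal. $\mathscr{U}_G$ is the set of all Gaussian rational unitary matrices $U$ with $Ue=e$ and $U^*A(G)U=A(H)$ for some $H\in\mathcal{G}_n^{sc}$. *)

theory Defs
  imports
    Complex_Main
    "HOL-Computational_Algebra.Factorial_Ring"
    "Jordan_Normal_Form.Determinant"
    "Jordan_Normal_Form.Schur_Decomposition"
begin

datatype gauss_int = Gauss_Int (ReZ: int) (ImZ: int)

lemma gauss_int_eq_iff: "z = w \<longleftrightarrow> ReZ z = ReZ w \<and> ImZ z = ImZ w"
  by (cases z; cases w) auto

instantiation gauss_int :: comm_ring_1
begin

definition "0 = Gauss_Int 0 0"
definition "1 = Gauss_Int 1 0"
definition "z + w = Gauss_Int (ReZ z + ReZ w) (ImZ z + ImZ w)"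
definition "z - w = Gauss_Int (ReZ z - ReZ w) (ImZ z - ImZ w)"
definition "- z = Gauss_Int (- ReZ z) (- ImZ z)"
definition "z * w =
  Gauss_Int (ReZ z * ReZ w - ImZ z * ImZ w) (ReZ z * ImZ w + ImZ z * ReZ w)"

instance
  by standard
    (simp_all add: gauss_int_eq_iff zero_gauss_int_def one_gauss_int_def plus_gauss_int_def
      minus_gauss_int_def uminus_gauss_int_def times_gauss_int_def algebra_simps)

end

definition gauss_i :: gauss_int where
  "gauss_i = Gauss_Int 0 1"

definition gauss_norm :: "gauss_int \<Rightarrow> int" where
  "gauss_norm z = (ReZ z)\<^sup>2 + (ImZ z)\<^sup>2"

definition of_gauss :: "gauss_int \<Rightarrow> complex" where
  "of_gauss z = Complex (of_int (ReZ z)) (of_int (ImZ z))"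

definition gauss_square_free :: "gauss_int \<Rightarrow> bool" where
  "gauss_square_free z \<longleftrightarrow> (\<forall>p. prime_elem p \<longrightarrow> \<not> p\<^sup>2 dvd z)"

text \<open>
  The vertex set \<open>[n]\<close> is rendered as \<open>{..<n}\<close>, matching the indexing of matrices from \<open>0\<close>.
  A mixed graph consists of the edges of the simple graph that were left unoriented
  and the arcs that arose by orienting the other edges.
\<close>

record mixed_graph =
  edges :: "nat set set"
  arcs :: "(nat \<times> nat) set"

definition mixed_graphs :: "nat \<Rightarrow> mixed_graph set" where
  "mixed_graphs n = {G.
     edges G \<subseteq> {{u, v} | u v. u < n \<and> v < n \<and> u \<noteq> v} \<and>
     arcs G \<subseteq> {(u, v). u < n \<and> v < n \<and> u \<noteq> v} \<and>
     (\<forall>(u, v) \<in> arcs G. {u, v} \<notin> edges G \<and> (v, u) \<notin> arcs G)}"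

definition converse_graph :: "mixed_graph \<Rightarrow> mixed_graph" where
  "converse_graph G = \<lparr>edges = edges G, arcs = (arcs G)\<inverse>\<rparr>"

definition mixed_graph_iso :: "nat \<Rightarrow> mixed_graph \<Rightarrow> mixed_graph \<Rightarrow> bool" where
  "mixed_graph_iso n G H \<longleftrightarrow> (\<exists>f. bij_betw f {..<n} {..<n} \<and>
     (\<forall>u<n. \<forall>v<n. ({u, v} \<in> edges G \<longleftrightarrow> {f u, f v} \<in> edges H) \<and>
                  ((u, v) \<in> arcs G \<longleftrightarrow> (f u, f v) \<in> arcs H)))"

definition self_converse_graphs :: "nat \<Rightarrow> mixed_graph set" where
  "self_converse_graphs n = {G \<in> mixed_graphs n. mixed_graph_iso n (converse_graph G) G}"

definition hermitian_adj :: "nat \<Rightarrow> mixed_graph \<Rightarrow> complex mat" where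
  "hermitian_adj n G = mat n n (\<lambda>(u, v).
     if {u, v} \<in> edges G then 1
     else if (u, v) \<in> arcs G then \<i>
     else if (v, u) \<in> arcs G then - \<i>
     else 0)"

definition all_one :: "nat \<Rightarrow> complex vec" where
  "all_one n = vec n (\<lambda>_. 1)"

definition walk_matrix :: "nat \<Rightarrow> mixed_graph \<Rightarrow> complex mat" where
  "walk_matrix n G =
     mat_of_cols n (map (\<lambda>k. (hermitian_adj n G ^\<^sub>m k) *\<^sub>v all_one n) [0..<n])"

definition gauss_rat_mat :: "complex mat \<Rightarrow> bool" where
  "gauss_rat_mat U \<longleftrightarrow> (\<forall>z \<in> elements_mat U. Re z \<in> \<rat> \<and> Im z \<in> \<rat>)"

definition gauss_int_mat :: "complex mat \<Rightarrow> bool" where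
  "gauss_int_mat U \<longleftrightarrow> elements_mat U \<subseteq> range of_gauss"

definition unitary_mat :: "nat \<Rightarrow> complex mat \<Rightarrow> bool" where
  "unitary_mat n U \<longleftrightarrow> U \<in> carrier_mat n n \<and> mat_adjoint U * U = 1\<^sub>m n"

definition gauss_quadrant :: "gauss_int set" where
  "gauss_quadrant = {z. ReZ z > 0 \<and> ImZ z \<ge> 0}"

definition level :: "complex mat \<Rightarrow> gauss_int" where
  "level U = (THE l. l \<in> gauss_quadrant \<and> gauss_int_mat (of_gauss l \<cdot>\<^sub>m U) \<and>
     (\<forall>m \<in> gauss_quadrant. gauss_int_mat (of_gauss m \<cdot>\<^sub>m U) \<longrightarrow> gauss_norm l \<le> gauss_norm m))"

definition unitary_class :: "nat \<Rightarrow> mixed_graph \<Rightarrow> complex mat set" where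
  "unitary_class n G = {U. unitary_mat n U \<and> gauss_rat_mat U \<and>
     U *\<^sub>v all_one n = all_one n \<and>
     (\<exists>H \<in> self_converse_graphs n.
        mat_adjoint U * hermitian_adj n G * U = hermitian_adj n H)}"

end

theory Submission
  imports Defs "HOL-Combinatorics.Permutations"
begin

text \<open>
  Write \<open>L = \<int>[i]\<^sup>n\<close> and let \<open>\<Lambda>\<close> be the lattice spanned by the walk vectors
  \<open>A\<^sup>k e\<close>; it is contained in \<open>L\<close> and in \<open>U L\<close>, both of which are stable under \<open>A\<close>.
  Self-converseness provides a permutation matrix \<open>P\<close> such that \<open>A\<close> is self-adjoint for the
  bilinear form \<open>\<langle>x, y\<rangle> = x\<^sup>T P y\<close>. As the walk matrix is nonsingular, \<open>U\<^sup>T P U\<close> is again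
  a permutation matrix, so the form is unimodular on \<open>L\<close> and on \<open>U L\<close>.

  Let a prime \<open>p\<close> divide the level while \<open>p\<^sup>2\<close> does not divide \<open>det W\<close>. Then, locally at \<open>p\<close>,
  \<open>\<Lambda>\<close> is \<open>L \<inter> U L\<close>, of index \<open>p\<close> in both lattices, and the form pairs \<open>L / \<Lambda>\<close> perfectly with
  \<open>U L / \<Lambda>\<close>. Hence \<open>A\<close> has the same eigenvalue on these two lines, and
  \<open>p (L + U L)\<close> yields a two-dimensional eigenspace of \<open>A\<close> on \<open>\<Lambda> / p \<Lambda>\<close>. This is impossible,
  because \<open>\<Lambda> / p \<Lambda>\<close> is cyclic.

  Now let \<open>\<pi> = 1 + i\<close> and suppose that \<open>2 = - i \<pi>\<^sup>2\<close> divides the level. Complex conjugation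
  permutes the rows of \<open>W\<close>, so \<open>d = det W / 2\<^bsup>\<lfloor>n/2\<rfloor>\<^esup>\<close> is real or purely imaginary and square-freeness
  makes it prime to \<open>\<pi>\<close>. For even \<open>n\<close> half of the form is then unimodular on \<open>\<Lambda>\<close> locally
  at \<open>\<pi>\<close>. The images of \<open>2 L\<close> and of \<open>2 U L\<close> in \<open>\<Lambda> / \<pi> \<Lambda> = F\<^sub>2[x] / (\<chi>)\<close> are isotropic ideals, that
  is, the squares of their generators vanish. As \<open>F\<^sub>2[x]\<close> is a principal ideal domain, the product of
  the two ideals vanishes as well, so they are orthogonal to each other and \<open>\<pi> U\<close> is integral at \<open>\<pi>\<close>. For
  odd \<open>n\<close> the same argument applies to the multiples of \<open>x\<close>, which are the vectors orthogonal to
  \<open>e\<close> modulo \<open>\<pi>\<close>.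
\<close>

section \<open>Arithmetic of Gaussian integers\<close>

lemma gauss_int_sel [simp]:
  "ReZ 0 = 0" "ImZ 0 = 0" "ReZ 1 = 1" "ImZ 1 = 0"
  "ReZ (z + w) = ReZ z + ReZ w" "ImZ (z + w) = ImZ z + ImZ w"
  "ReZ (z - w) = ReZ z - ReZ w" "ImZ (z - w) = ImZ z - ImZ w"
  "ReZ (- z) = - ReZ z" "ImZ (- z) = - ImZ z"
  "ReZ (z * w) = ReZ z * ReZ w - ImZ z * ImZ w"
  "ImZ (z * w) = ReZ z * ImZ w + ImZ z * ReZ w"
  "ReZ gauss_i = 0" "ImZ gauss_i = 1"
  by (simp_all add: zero_gauss_int_def one_gauss_int_def plus_gauss_int_def
      minus_gauss_int_def uminus_gauss_int_def times_gauss_int_def gauss_i_def)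

lemma gauss_int_numeral_sel [simp]: "ReZ (numeral k) = numeral k" "ImZ (numeral k) = 0"
proof -
  have "ReZ (of_nat m) = int m \<and> ImZ (of_nat m) = 0" for m
    by (induction m) auto
  from this[of "numeral k"] show "ReZ (numeral k) = numeral k" "ImZ (numeral k) = 0"
    by auto
qed

lemma gauss_norm_mult: "gauss_norm (z * w) = gauss_norm z * gauss_norm w"
  by (simp add: gauss_norm_def power2_eq_square algebra_simps)

lemma gauss_norm_nonneg [simp]: "gauss_norm z \<ge> 0"
  by (simp add: gauss_norm_def)

lemma gauss_norm_eq_0_iff [simp]: "gauss_norm z = 0 \<longleftrightarrow> z = 0"
  by (simp add: gauss_norm_def gauss_int_eq_iff sum_power2_eq_zero_iff)

lemma gauss_norm_pos_iff [simp]: "gauss_norm z > 0 \<longleftrightarrow> z \<noteq> 0"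
  using gauss_norm_nonneg[of z] gauss_norm_eq_0_iff[of z] by linarith

instance gauss_int :: idom
proof
  fix a b :: gauss_int
  assume "a \<noteq> 0" "b \<noteq> 0"
  hence "gauss_norm (a * b) \<noteq> 0"
    by (simp add: gauss_norm_mult del: gauss_norm_eq_0_iff) simp
  thus "a * b \<noteq> 0" by simp
qed

lemma gauss_int_two_neq_0 [simp]: "(2 :: gauss_int) \<noteq> 0"
  by (simp add: gauss_int_eq_iff)

definition gauss_cnj :: "gauss_int \<Rightarrow> gauss_int" where
  "gauss_cnj z = Gauss_Int (ReZ z) (- ImZ z)"

lemma gauss_cnj_sel [simp]: "ReZ (gauss_cnj z) = ReZ z" "ImZ (gauss_cnj z) = - ImZ z"
  by (simp_all add: gauss_cnj_def)

lemma gauss_cnj_cnj [simp]: "gauss_cnj (gauss_cnj z) = z"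
  by (simp add: gauss_int_eq_iff)

interpretation gauss_cnj: comm_ring_hom gauss_cnj
  by standard (simp_all add: gauss_int_eq_iff)

interpretation of_gauss: inj_comm_ring_hom of_gauss
  by standard (auto simp: of_gauss_def complex_eq_iff gauss_int_eq_iff)

lemma of_gauss_cnj: "of_gauss (gauss_cnj z) = cnj (of_gauss z)"
  by (simp add: of_gauss_def complex_eq_iff)

lemma gauss_norm_cnj [simp]: "gauss_norm (gauss_cnj z) = gauss_norm z"
  by (simp add: gauss_norm_def)

lemma gauss_unit_iff: "z dvd 1 \<longleftrightarrow> gauss_norm z = 1"
proof
  assume "z dvd 1"
  then obtain w where "1 = z * w" by (rule dvdE)
  hence "gauss_norm z * gauss_norm w = 1"
    by (metis gauss_norm_mult gauss_norm_def gauss_int_sel(3,4) one_power2 zero_power2 add.right_neutral)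
  thus "gauss_norm z = 1"
    using gauss_norm_nonneg[of z] by (simp add: zmult_eq_1_iff)
next
  assume "gauss_norm z = 1"
  hence "z * gauss_cnj z = 1"
    by (simp add: gauss_int_eq_iff gauss_norm_def power2_eq_square)
  thus "z dvd 1" by (metis dvd_triv_left)
qed

section \<open>Euclidean division and prime elements of the Gaussian integers\<close>

lemma int_nearest_multiple:
  fixes x N :: int
  assumes "N > 0"
  shows "\<exists>q. 2 * \<bar>x - q * N\<bar> \<le> N"
proof -
  have eq: "x = x div N * N + x mod N" by simp
  have bd: "0 \<le> x mod N" "x mod N < N" using assms by auto
  show ?thesis
  proof (cases "2 * (x mod N) \<le> N")
    case True
    have "x - x div N * N = x mod N" using eq by linarith
    thus ?thesis using True bd by (intro exI[of _ "x div N"]) simp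
  next
    case False
    have "x - (x div N + 1) * N = x mod N - N" using eq by (simp add: algebra_simps)
    thus ?thesis using False bd by (intro exI[of _ "x div N + 1"]) simp
  qed
qed

text \<open>Rounding both coordinates of the exact quotient \<open>a * gauss_cnj b / N\<close> to
  nearest integers leaves an error of norm at most 1/2, so the remainder has at most half the norm
  of \<open>b\<close>.\<close>

lemma gauss_euclidean_division:
  assumes "b \<noteq> 0"
  shows "\<exists>q. gauss_norm (a - q * b) < gauss_norm b"
proof -
  define N where "N = gauss_norm b"
  have N: "N > 0" using assms by (simp add: N_def)
  define c where "c = a * gauss_cnj b"
  obtain q1 where q1: "2 * \<bar>ReZ c - q1 * N\<bar> \<le> N" using int_nearest_multiple[OF N] by blast
  obtain q2 where q2: "2 * \<bar>ImZ c - q2 * N\<bar> \<le> N" using int_nearest_multiple[OF N] by blast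
  define q where "q = Gauss_Int q1 q2"
  have "b * gauss_cnj b = Gauss_Int N 0"
    by (simp add: gauss_int_eq_iff N_def gauss_norm_def power2_eq_square)
  hence "(a - q * b) * gauss_cnj b = c - q * Gauss_Int N 0"
    by (simp add: c_def left_diff_distrib mult.assoc)
  hence "gauss_norm (a - q * b) * N = gauss_norm (c - q * Gauss_Int N 0)"
    by (metis N_def gauss_norm_cnj gauss_norm_mult)
  also have "\<dots> = (ReZ c - q1 * N)\<^sup>2 + (ImZ c - q2 * N)\<^sup>2"
    by (simp add: gauss_norm_def q_def)
  finally have eq: "gauss_norm (a - q * b) * N = (ReZ c - q1 * N)\<^sup>2 + (ImZ c - q2 * N)\<^sup>2" .
  have "4 * x\<^sup>2 \<le> N\<^sup>2" if "2 * \<bar>x\<bar> \<le> N" for x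
    using that N abs_le_square_iff[of "2 * x" N] by (simp add: power_mult_distrib abs_mult)
  from this[OF q1] this[OF q2] have "4 * (gauss_norm (a - q * b) * N) \<le> 2 * N\<^sup>2"
    unfolding eq by simp
  hence "2 * gauss_norm (a - q * b) \<le> N"
    using N by (simp add: power2_eq_square)
  hence "gauss_norm (a - q * b) < N" using N gauss_norm_nonneg[of "a - q * b"] by linarith
  thus ?thesis unfolding N_def by blast
qed

text \<open>A nonzero element of least norm works, since division by it leaves a remainder in
  \<open>I\<close> of smaller norm. This serves both for Bezout identities and for the ideal of
  denominators of a matrix.\<close>

lemma gauss_ideal_generator:
  fixes I :: "gauss_int set"
  assumes "x0 \<in> I" "x0 \<noteq> 0"
    and diff: "\<And>x y. x \<in> I \<Longrightarrow> y \<in> I \<Longrightarrow> x - y \<in> I"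
    and mult: "\<And>r x. x \<in> I \<Longrightarrow> r * x \<in> I"
  shows "\<exists>g \<in> I. g \<noteq> 0 \<and> (\<forall>x \<in> I. g dvd x)"
proof -
  define g where "g = (ARG_MIN (\<lambda>z. nat (gauss_norm z)) z. z \<in> I \<and> z \<noteq> 0)"
  have g: "g \<in> I" "g \<noteq> 0"
    using arg_min_natI[of "\<lambda>z. z \<in> I \<and> z \<noteq> 0" x0 "\<lambda>z. nat (gauss_norm z)"] assms(1,2)
    by (auto simp: g_def)
  have min: "gauss_norm g \<le> gauss_norm z" if "z \<in> I" "z \<noteq> 0" for z
    using arg_min_nat_le[of "\<lambda>z. z \<in> I \<and> z \<noteq> 0" z "\<lambda>z. nat (gauss_norm z)"] that
    by (simp add: g_def nat_le_iff)
  have "g dvd x" if "x \<in> I" for x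
  proof -
    obtain q where q: "gauss_norm (x - q * g) < gauss_norm g"
      using gauss_euclidean_division[OF g(2)] by blast
    have "x - q * g \<in> I" using diff mult g that by blast
    with q min have "x - q * g = 0" by fastforce
    thus ?thesis by (simp add: dvd_def mult.commute)
  qed
  with g show ?thesis by blast
qed

text \<open>The generator of the ideal spanned by \<open>p\<close> and \<open>a\<close> divides
  \<open>p\<close>. If it is a multiple of \<open>p\<close>, then \<open>p dvd a\<close>; if it is a
  unit, multiplying its Bezout expression by \<open>b\<close> gives \<open>p dvd b\<close>.\<close>

lemma gauss_irreducible_imp_prime_elem:
  assumes "p \<noteq> 0" "\<not> p dvd 1" and irr: "\<And>g. g dvd p \<Longrightarrow> g dvd 1 \<or> p dvd g"
  shows "prime_elem (p :: gauss_int)"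
proof (rule prime_elemI)
  fix a b assume ab: "p dvd a * b"
  define I where "I = {x * p + y * a | x y. True}"
  have inI: "x * p + y * a \<in> I" for x y unfolding I_def by blast
  have "\<exists>g \<in> I. g \<noteq> 0 \<and> (\<forall>x \<in> I. g dvd x)"
  proof (rule gauss_ideal_generator)
    show "p \<in> I" using inI[of 1 0] by simp
    show "x - y \<in> I" if xy: "x \<in> I" "y \<in> I" for x y
    proof -
      obtain x1 x2 y1 y2 where "x = x1 * p + x2 * a" "y = y1 * p + y2 * a"
        using xy unfolding I_def by blast
      hence "x - y = (x1 - y1) * p + (x2 - y2) * a" by (simp add: algebra_simps)
      thus ?thesis using inI by metis
    qed
    show "r * x \<in> I" if x: "x \<in> I" for r x
    proof -
      obtain x1 x2 where "x = x1 * p + x2 * a" using x unfolding I_def by blast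
      hence "r * x = (r * x1) * p + (r * x2) * a" by (simp add: algebra_simps)
      thus ?thesis using inI by metis
    qed
  qed (fact assms)
  then obtain x y where g: "\<forall>z \<in> I. (x * p + y * a) dvd z" unfolding I_def by blast
  have gp: "x * p + y * a dvd p" using g inI[of 1 0] by simp
  have ga: "x * p + y * a dvd a" using g inI[of 0 1] by simp
  show "p dvd a \<or> p dvd b"
  proof (cases "p dvd x * p + y * a")
    case True
    thus ?thesis using ga dvd_trans by blast
  next
    case False
    with irr[OF gp] have "x * p + y * a dvd 1" by blast
    hence "(x * p + y * a) * b dvd b" by (metis mult_1 mult_dvd_mono dvd_refl)
    moreover have "p dvd (x * p + y * a) * b"
      using ab by (simp add: distrib_right mult.assoc)
    ultimately show ?thesis using dvd_trans by blast
  qed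
qed fact+

text \<open>A nonunit divisor of least norm is irreducible.\<close>

lemma gauss_prime_divisor_exists:
  assumes "z \<noteq> 0" "\<not> z dvd 1"
  shows "\<exists>p. prime_elem p \<and> p dvd (z :: gauss_int)"
proof -
  define p where "p = (ARG_MIN (\<lambda>z. nat (gauss_norm z)) p. p dvd z \<and> \<not> p dvd 1)"
  have p: "p dvd z" "\<not> p dvd 1"
    using arg_min_natI[of "\<lambda>p. p dvd z \<and> \<not> p dvd 1" z "\<lambda>z. nat (gauss_norm z)"] assms
    by (auto simp: p_def)
  have min: "gauss_norm p \<le> gauss_norm g" if "g dvd z" "\<not> g dvd 1" for g
    using arg_min_nat_le[of "\<lambda>p. p dvd z \<and> \<not> p dvd 1" g "\<lambda>z. nat (gauss_norm z)"] that
    by (simp add: p_def nat_le_eq_zle)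
  have p0: "p \<noteq> 0" using p assms by auto
  have "prime_elem p"
  proof (rule gauss_irreducible_imp_prime_elem)
    fix g assume "g dvd p"
    then obtain h where h: "p = g * h" by (rule dvdE)
    show "g dvd 1 \<or> p dvd g"
    proof (cases "g dvd 1")
      case False
      have "gauss_norm g * gauss_norm h \<le> gauss_norm g * 1"
        using min[of g] False p(1) h gauss_norm_mult[of g h] dvd_trans[of g p z] by simp
      moreover have "gauss_norm g > 0" "gauss_norm h > 0" using p0 h by auto
      ultimately have "gauss_norm h \<le> 1" "gauss_norm h > 0"
        by (simp_all add: mult_le_cancel_left)
      hence "gauss_norm h = 1" by linarith
      then obtain k where k: "1 = h * k" by (auto simp: gauss_unit_iff[symmetric] elim!: dvdE)
      have "g = p * k" unfolding h by (simp add: mult.assoc k[symmetric])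
      thus ?thesis by simp
    qed simp
  qed (use p p0 in auto)
  with p show ?thesis by blast
qed

section \<open>Parity and the prime 1 + i\<close>

lemma one_plus_i_dvd_iff: "1 + gauss_i dvd z \<longleftrightarrow> even (ReZ z + ImZ z)"
proof
  assume "1 + gauss_i dvd z"
  then obtain w where "z = (1 + gauss_i) * w" by (rule dvdE)
  thus "even (ReZ z + ImZ z)" by simp
next
  assume "even (ReZ z + ImZ z)"
  then obtain k where k: "ReZ z + ImZ z = 2 * k" by (rule evenE)
  \<comment> \<open>The cofactor is z (1 - i) / 2.\<close>
  have "z = (1 + gauss_i) * Gauss_Int k (k - ReZ z)"
    using k by (simp add: gauss_int_eq_iff)
  thus "1 + gauss_i dvd z" by (metis dvd_triv_left)
qed

lemma two_dvd_gauss_iff: "2 dvd z \<longleftrightarrow> even (ReZ z) \<and> even (ImZ z)"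
proof
  assume "2 dvd z"
  then obtain w where "z = 2 * w" by (rule dvdE)
  thus "even (ReZ z) \<and> even (ImZ z)" by simp
next
  assume "even (ReZ z) \<and> even (ImZ z)"
  then obtain a b where "ReZ z = 2 * a" "ImZ z = 2 * b" by (auto elim!: evenE)
  hence "z = 2 * Gauss_Int a b" by (simp add: gauss_int_eq_iff)
  thus "2 dvd z" by (metis dvd_triv_left)
qed

lemma one_plus_i_dvd_2: "1 + gauss_i dvd 2"
  by (simp add: one_plus_i_dvd_iff)

lemma one_plus_i_square_dvd_iff: "(1 + gauss_i)\<^sup>2 dvd z \<longleftrightarrow> 2 dvd z"
proof -
  have "(1 + gauss_i)\<^sup>2 = gauss_i * 2"
    by (simp add: gauss_int_eq_iff power2_eq_square)
  moreover have "gauss_i * 2 dvd z \<longleftrightarrow> 2 dvd z"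
    by (rule mult_unit_dvd_iff') (simp add: gauss_unit_iff gauss_norm_def)
  ultimately show ?thesis by simp
qed

lemma prime_elem_one_plus_i: "prime_elem (1 + gauss_i)"
  by (rule prime_elemI)
    (auto simp: one_plus_i_dvd_iff gauss_int_eq_iff)

text \<open>Up to a unit \<open>2\<close> is the square of \<open>1 + gauss_i\<close>, so
  \<open>p\<close> divides the prime \<open>1 + gauss_i\<close>, and the cofactor cannot absorb that
  prime.\<close>

lemma prime_elem_dvd_2_imp:
  assumes "prime_elem p" "p dvd 2"
  shows "1 + gauss_i dvd p"
proof -
  have "p dvd (1 + gauss_i)\<^sup>2"
    using assms(2) by (meson one_plus_i_square_dvd_iff dvd_refl dvd_trans)
  hence "p dvd 1 + gauss_i" using assms(1) by (metis prime_elem_dvd_power)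
  then obtain q where q: "1 + gauss_i = p * q" by (rule dvdE)
  hence "1 + gauss_i dvd p \<or> 1 + gauss_i dvd q"
    using prime_elem_one_plus_i by (metis dvd_refl prime_elem_dvd_mult_iff)
  moreover have "\<not> 1 + gauss_i dvd q"
  proof
    assume "1 + gauss_i dvd q"
    then obtain r where "q = (1 + gauss_i) * r" by (rule dvdE)
    hence "(1 + gauss_i) * (p * r) = (1 + gauss_i) * 1" using q by (simp add: ac_simps)
    hence "p * r = 1" by (simp add: gauss_int_eq_iff)
    thus False using assms(1) by (metis dvd_triv_left prime_elem_def)
  qed
  ultimately show ?thesis by blast
qed

section \<open>Determinants of matrices given by functions\<close>

definition fdet :: "nat \<Rightarrow> (nat \<Rightarrow> nat \<Rightarrow> 'a) \<Rightarrow> 'a :: comm_ring_1" where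
  "fdet n M = det (mat n n (\<lambda>(i, j). M i j))"

lemma fdet_cong:
  assumes "\<And>i j. i < n \<Longrightarrow> j < n \<Longrightarrow> M i j = N i j"
  shows "fdet n M = fdet n N"
proof -
  have "mat n n (\<lambda>(i, j). M i j) = mat n n (\<lambda>(i, j). N i j)"
    by (rule eq_matI) (auto simp: assms)
  thus ?thesis by (simp add: fdet_def)
qed

lemma fdet_mult:
  "fdet n (\<lambda>i j. \<Sum>k<n. M i k * N k j) = fdet n M * fdet n N"
proof -
  have "mat n n (\<lambda>(i, j). \<Sum>k<n. M i k * N k j) =
      mat n n (\<lambda>(i, j). M i j) * mat n n (\<lambda>(i, j). N i j)"
    by (rule eq_matI) (auto simp: scalar_prod_def lessThan_atLeast0)
  thus ?thesis by (simp add: fdet_def det_mult[of _ n])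
qed

lemma fdet_transpose: "fdet n (\<lambda>i j. M j i) = fdet n M"
proof -
  have "mat n n (\<lambda>(i, j). M j i) = transpose_mat (mat n n (\<lambda>(i, j). M i j))"
    by (rule eq_matI) auto
  thus ?thesis by (simp add: fdet_def det_transpose[of _ n])
qed

lemma fdet_permute_rows:
  assumes "f permutes {..<n}"
  shows "fdet n (\<lambda>i j. M (f i) j) = fdet n M \<or> fdet n (\<lambda>i j. M (f i) j) = - fdet n M"
proof -
  have p: "f permutes {0..<n}" using assms by (simp add: lessThan_atLeast0)
  have "f i < n" if "i < n" for i using permutes_in_image[OF assms, of i] that by simp
  hence "mat n n (\<lambda>(i, j). mat n n (\<lambda>(i, j). M i j) $$ (f i, j)) = mat n n (\<lambda>(i, j). M (f i) j)"
    by (intro eq_matI) auto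
  with det_permute_rows[of "mat n n (\<lambda>(i, j). M i j)" n, OF _ p]
  have "fdet n (\<lambda>i j. M (f i) j) = signof f * fdet n M"
    by (simp add: fdet_def)
  thus ?thesis by (cases "evenperm f") (auto simp: sign_def)
qed

lemma fdet_adjugate:
  fixes M :: "nat \<Rightarrow> nat \<Rightarrow> 'a :: comm_ring_1"
  obtains N where
    "\<And>i j. i < n \<Longrightarrow> j < n \<Longrightarrow> (\<Sum>k<n. N i k * M k j) = (if i = j then fdet n M else 0)"
    "\<And>i j. i < n \<Longrightarrow> j < n \<Longrightarrow> (\<Sum>k<n. M i k * N k j) = (if i = j then fdet n M else 0)"
proof
  define A where "A = mat n n (\<lambda>(i, j). M i j)"
  define N where "N = (\<lambda>i j. adj_mat A $$ (i, j))"
  have A: "A \<in> carrier_mat n n" by (simp add: A_def)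
  note adj = adj_mat[OF A]
  fix i j assume ij: "i < n" "j < n"
  have "(\<Sum>k<n. N i k * M k j) = (adj_mat A * A) $$ (i, j)"
    using ij adj(1) A by (auto simp: scalar_prod_def N_def A_def lessThan_atLeast0 intro!: sum.cong)
  thus "(\<Sum>k<n. N i k * M k j) = (if i = j then fdet n M else 0)"
    using ij adj(3) by (simp add: fdet_def A_def)
  have "(\<Sum>k<n. M i k * N k j) = (A * adj_mat A) $$ (i, j)"
    using ij adj(1) A by (auto simp: scalar_prod_def N_def A_def lessThan_atLeast0 intro!: sum.cong)
  thus "(\<Sum>k<n. M i k * N k j) = (if i = j then fdet n M else 0)"
    using ij adj(2) by (simp add: fdet_def A_def)
qed

lemma sum_sum_swap_mult:
  fixes a :: "'a \<Rightarrow> 'c :: comm_semiring_0"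
  shows "(\<Sum>i\<in>I. a i * (\<Sum>j\<in>J. b i j * c j)) = (\<Sum>j\<in>J. (\<Sum>i\<in>I. a i * b i j) * c j)"
  by (simp add: sum_distrib_left sum_distrib_right mult.assoc) (rule sum.swap)

lemma fdet_nonzero_kernel_trivial:
  fixes M :: "nat \<Rightarrow> nat \<Rightarrow> 'a :: idom"
  assumes "fdet n M \<noteq> 0" "\<And>i. i < n \<Longrightarrow> (\<Sum>j<n. M i j * x j) = 0" "k < n"
  shows "x k = 0"
proof -
  obtain N where N: "\<And>i j. i < n \<Longrightarrow> j < n \<Longrightarrow>
      (\<Sum>k<n. N i k * M k j) = (if i = j then fdet n M else 0)"
    using fdet_adjugate[of n M] by metis
  have "0 = (\<Sum>i<n. N k i * (\<Sum>j<n. M i j * x j))" using assms(2) by simp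
  also have "\<dots> = (\<Sum>j<n. (\<Sum>i<n. N k i * M i j) * x j)" by (rule sum_sum_swap_mult)
  also have "\<dots> = (\<Sum>j<n. if k = j then fdet n M * x j else 0)"
    using N assms(3) by (intro sum.cong) auto
  also have "\<dots> = fdet n M * x k" using assms(3) by simp
  finally show ?thesis using assms(1) by simp
qed

section \<open>Determinants and left kernels modulo a prime\<close>

lemma fdet_row_identity:
  fixes w :: "nat \<Rightarrow> 'a :: comm_ring_1"
  assumes "i < n"
  shows "fdet n (\<lambda>k l. if k = i then w l else if k = l then 1 else 0) = w i"
proof -
  define T where "T = mat n n (\<lambda>(k, l). if k = i then w l else if k = l then (1 :: 'a) else 0)"
  have T: "T \<in> carrier_mat n n" by (simp add: T_def)
  have "det T = (\<Sum>k<n. T $$ (k, i) * cofactor T k i)"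
    by (rule laplace_expansion_column[OF T assms])
  also have "\<dots> = (\<Sum>k<n. if k = i then w i * cofactor T i i else 0)"
    using assms by (intro sum.cong) (auto simp: T_def)
  also have "\<dots> = w i * cofactor T i i" using assms by simp
  also have "mat_delete T i i = 1\<^sub>m (n - 1)"
    using assms by (intro eq_matI) (auto simp: mat_delete_def T_def)
  hence "cofactor T i i = 1" by (simp add: cofactor_def)
  finally show ?thesis by (simp add: fdet_def T_def)
qed

text \<open>A form of Cramer's rule: left multiplication by the identity matrix with row
  \<open>i\<close> replaced by \<open>w\<close> multiplies the determinant by \<open>w i\<close> and
  turns row \<open>i\<close> of \<open>M\<close> into \<open>p * r\<close>.\<close>

lemma fdet_replace_row:
  fixes M :: "nat \<Rightarrow> nat \<Rightarrow> 'a :: comm_ring_1"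
  assumes "i < n" "\<And>k. k < n \<Longrightarrow> (\<Sum>l<n. w l * M l k) = p * r k"
  shows "w i * fdet n M = p * fdet n (\<lambda>l k. if l = i then r k else M l k)"
proof -
  have "w i * fdet n M =
      fdet n (\<lambda>k l. \<Sum>j<n. (if k = i then w j else if k = j then 1 else 0) * M j l)"
    using assms(1) by (simp only: fdet_mult fdet_row_identity)
  also have "\<dots> = fdet n (\<lambda>k l. \<Sum>j<n. (if k = i then (if j = i then p else 0)
      else if k = j then 1 else 0) * (if j = i then r l else M j l))"
  proof (rule fdet_cong)
    fix k l assume kl: "k < n" "l < n"
    show "(\<Sum>j<n. (if k = i then w j else if k = j then 1 else 0) * M j l) =
      (\<Sum>j<n. (if k = i then if j = i then p else 0 else if k = j then 1 else 0) *
               (if j = i then r l else M j l))"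
      using kl assms by (cases "k = i") (simp_all add: if_distrib[of "\<lambda>x. x * _"] cong: if_cong)
  qed
  also have "\<dots> = p * fdet n (\<lambda>l k. if l = i then r k else M l k)"
    using assms(1) by (simp only: fdet_mult fdet_row_identity) simp
  finally show ?thesis .
qed

lemma prime_elem_square_dvd_multD:
  fixes p :: "'a :: idom"
  assumes p: "prime_elem p" and dvd: "p\<^sup>2 dvd a * b" and na: "\<not> p dvd a"
  shows "p\<^sup>2 dvd b"
proof -
  have p0: "p \<noteq> 0" using p by auto
  have "p dvd a * b" using dvd by (metis dvd_mult_left power2_eq_square)
  hence "p dvd b" using p na by (simp add: prime_elem_dvd_mult_iff)
  then obtain c where c: "b = p * c" by (rule dvdE)
  have "p * p dvd p * (a * c)" using dvd by (simp add: c power2_eq_square ac_simps)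
  hence "p dvd a * c" using p0 by simp
  hence "p dvd c" using p na by (simp add: prime_elem_dvd_mult_iff)
  thus ?thesis by (simp add: c power2_eq_square)
qed

text \<open>The left kernel of \<open>M\<close> modulo \<open>p\<close> is at most a line: two
  independent kernel vectors would let a factor \<open>p\<close> be extracted from each of two
  rows.\<close>

lemma left_kernel_mod_prime_dependent:
  fixes M :: "nat \<Rightarrow> nat \<Rightarrow> 'a :: idom"
  assumes p: "prime_elem p" and nd: "\<not> p\<^sup>2 dvd fdet n M"
    and w: "\<And>k. k < n \<Longrightarrow> p dvd (\<Sum>l<n. w l * M l k)"
    and w': "\<And>k. k < n \<Longrightarrow> p dvd (\<Sum>l<n. w' l * M l k)"
    and ij: "i < n" "j < n"
  shows "p dvd w i * w' j - w' i * w j"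
proof (rule ccontr)
  assume ndvd: "\<not> p dvd w i * w' j - w' i * w j"
  have main: False
    if x: "\<And>k. k < n \<Longrightarrow> p dvd (\<Sum>l<n. x l * M l k)" and xi: "\<not> p dvd x i" for x
  proof -
    obtain r where r: "\<And>k. k < n \<Longrightarrow> (\<Sum>l<n. x l * M l k) = p * r k"
      using x unfolding dvd_def by metis
    define M1 where "M1 = (\<lambda>l k. if l = i then r k else M l k)"
    have d1: "x i * fdet n M = p * fdet n M1"
      unfolding M1_def by (rule fdet_replace_row[OF ij(1) r])
    \<comment> \<open>This combination vanishes at \<open>i\<close>, so it remains in the kernel
      after row \<open>i\<close> is replaced, and a second factor \<open>p\<close> comes out of row
      \<open>j\<close>.\<close>
    define y where "y = (\<lambda>l. w i * w' l - w' i * w l)"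
    have yi: "y i = 0" by (simp add: y_def)
    have "p dvd (\<Sum>l<n. y l * M1 l k)" if k: "k < n" for k
    proof -
      have "(\<Sum>l<n. y l * M1 l k) = (\<Sum>l<n. y l * M l k)"
        by (intro sum.cong) (auto simp: M1_def yi)
      also have "\<dots> = w i * (\<Sum>l<n. w' l * M l k) - w' i * (\<Sum>l<n. w l * M l k)"
        by (simp add: y_def sum_distrib_left sum_subtractf algebra_simps)
      finally show ?thesis using w[OF k] w'[OF k] by (simp add: dvd_diff)
    qed
    then obtain r' where r': "\<And>k. k < n \<Longrightarrow> (\<Sum>l<n. y l * M1 l k) = p * r' k"
      unfolding dvd_def by metis
    obtain D where d2: "y j * fdet n M1 = p * D"
      using fdet_replace_row[of j n y M1 p r', OF ij(2) r'] by blast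
    have "y j * (x i * fdet n M) = p\<^sup>2 * D"
      using d1 d2 by (metis mult.left_commute power2_eq_square mult.assoc)
    hence dvd: "p\<^sup>2 dvd y j * (x i * fdet n M)" by simp
    have yj: "\<not> p dvd y j" using ndvd by (simp add: y_def)
    have "\<not> p dvd y j * x i" using p yj xi by (simp add: prime_elem_dvd_mult_iff)
    with dvd nd show False
      using prime_elem_square_dvd_multD[OF p] by (metis mult.assoc)
  qed
  have "\<not> p dvd w i \<or> \<not> p dvd w' i" using ndvd by (auto simp: dvd_diff)
  thus False using main w w' by blast
qed

section \<open>The walk lattice and its bilinear form\<close>

text \<open>\<open>converse\<close> says that the permutation matrix of \<open>f\<close> conjugates
  \<open>A\<close> into its transpose; in the application \<open>f\<close> is an isomorphism from
  the converse graph to the graph.\<close>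

locale walk_lattice =
  fixes n :: nat and A :: "nat \<Rightarrow> nat \<Rightarrow> 'a :: idom" and f :: "nat \<Rightarrow> nat"
  assumes perm: "f permutes {..<n}"
    and converse: "\<And>u v. u < n \<Longrightarrow> v < n \<Longrightarrow> A v u = A (f u) (f v)"
begin

definition app :: "(nat \<Rightarrow> 'a) \<Rightarrow> nat \<Rightarrow> 'a" where
  "app x u = (\<Sum>v<n. A u v * x v)"

definition walk :: "nat \<Rightarrow> nat \<Rightarrow> 'a" where
  "walk k = (app ^^ k) (\<lambda>_. 1)"

definition form :: "(nat \<Rightarrow> 'a) \<Rightarrow> (nat \<Rightarrow> 'a) \<Rightarrow> 'a" where
  "form x y = (\<Sum>u<n. x u * y (f u))"

text \<open>The number e^T A^k e. By \<open>form_walk_walk\<close> the Gram matrix of the walk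
  vectors is the Hankel matrix of these moments.\<close>

definition moment :: "nat \<Rightarrow> 'a" where
  "moment k = (\<Sum>u<n. walk k u)"

definition walk_det :: 'a where
  "walk_det = fdet n (\<lambda>u k. walk k u)"

lemma perm_less [simp]: "f u < n \<longleftrightarrow> u < n"
  using permutes_in_image[OF perm, of u] by simp

lemma sum_perm: "(\<Sum>u<n. g (f u)) = (\<Sum>u<n. g u)"
  by (rule sum.reindex_bij_betw[OF permutes_imp_bij[OF perm]])

lemma perm_surj: "v < n \<Longrightarrow> \<exists>u<n. v = f u"
  using permutes_surj[OF perm] by (metis perm_less surjD)

lemma walk_0 [simp]: "walk 0 = (\<lambda>_. 1)"
  by (simp add: walk_def)

lemma walk_Suc [simp]: "walk (Suc k) = app (walk k)"
  by (simp add: walk_def)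

lemma app_cong: "(\<And>v. v < n \<Longrightarrow> x v = y v) \<Longrightarrow> app x = app y"
  by (auto simp: app_def intro!: ext sum.cong)

lemma app_diff: "app (\<lambda>u. x u - y u) = (\<lambda>u. app x u - app y u)"
  by (rule ext) (simp add: app_def right_diff_distrib sum_subtractf)

lemma app_scale: "app (\<lambda>u. c * x u) = (\<lambda>u. c * app x u)"
  by (rule ext) (simp add: app_def sum_distrib_left mult.left_commute)

lemma app_sum: "app (\<lambda>u. \<Sum>k\<in>K. x k u) = (\<lambda>u. \<Sum>k\<in>K. app (x k) u)"
  by (intro ext) (simp add: app_def sum_distrib_left sum.swap[of _ K])

lemma form_cong:
  assumes "\<And>u. u < n \<Longrightarrow> x u = x' u" "\<And>u. u < n \<Longrightarrow> y u = y' u"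
  shows "form x y = form x' y'"
  by (auto simp: form_def assms intro!: sum.cong)

lemma form_diff_right: "form x (\<lambda>u. y u - z u) = form x y - form x z"
  by (simp add: form_def right_diff_distrib sum_subtractf)

lemma form_scale_right: "form x (\<lambda>u. c * y u) = c * form x y"
  by (simp add: form_def sum_distrib_left mult.left_commute)

lemma form_add_left: "form (\<lambda>u. x u + y u) z = form x z + form y z"
  by (simp add: form_def distrib_right sum.distrib)

lemma form_diff_left: "form (\<lambda>u. x u - y u) z = form x z - form y z"
  by (simp add: form_def left_diff_distrib sum_subtractf)

lemma form_scale_left: "form (\<lambda>u. c * x u) y = c * form x y"
  by (simp add: form_def sum_distrib_left mult.assoc)

lemma form_sum_right: "form x (\<lambda>u. \<Sum>k\<in>K. y k u) = (\<Sum>k\<in>K. form x (y k))"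
  by (simp add: form_def sum_distrib_left sum.swap[of _ K])

lemma form_one_left: "form (\<lambda>_. 1) y = (\<Sum>u<n. y u)"
  by (simp add: form_def sum_perm)

lemma form_delta: "u < n \<Longrightarrow> form x (\<lambda>v. if v = f u then 1 else 0) = x u"
  by (simp add: form_def inj_eq[OF permutes_inj[OF perm]] if_distrib[of "\<lambda>t. _ * t"] cong: if_cong)

text \<open>Moving \<open>A\<close> across the form transposes it and relabels it by
  \<open>f\<close>; by \<open>converse\<close> the two effects cancel.\<close>

lemma form_app: "form (app x) y = form x (app y)"
proof -
  have "form x (app y) = (\<Sum>v<n. x v * (\<Sum>u<n. A (f v) u * y u))"
    by (simp add: form_def app_def)
  also have "\<dots> = (\<Sum>v<n. x v * (\<Sum>u<n. A (f v) (f u) * y (f u)))"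
    by (subst sum_perm[of "\<lambda>u. A (f _) u * y u"]) simp
  also have "\<dots> = (\<Sum>v<n. x v * (\<Sum>u<n. A u v * y (f u)))"
    by (simp add: converse[symmetric])
  also have "\<dots> = (\<Sum>u<n. (\<Sum>v<n. x v * A u v) * y (f u))"
    by (rule sum_sum_swap_mult)
  also have "\<dots> = form (app x) y"
    by (simp add: form_def app_def mult.commute)
  finally show ?thesis ..
qed

lemma form_app_funpow: "form ((app ^^ k) x) y = form x ((app ^^ k) y)"
  by (induction k arbitrary: y) (simp_all add: form_app funpow_swap1[symmetric])

lemma form_walk_left: "form (walk k) y = (\<Sum>u<n. (app ^^ k) y u)"
  by (simp add: walk_def form_app_funpow form_one_left)

lemma form_walk_right: "form x (walk k) = form ((app ^^ k) x) (\<lambda>_. 1)"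
  by (simp add: walk_def form_app_funpow)

lemma form_walk_walk: "form (walk i) (walk j) = moment (i + j)"
  by (simp add: form_walk_left moment_def) (simp add: walk_def funpow_add)

lemma form_one_right: "form x (\<lambda>_. 1) = (\<Sum>u<n. x u)"
  by (simp add: form_def)

lemma walk_combination_unique:
  assumes "walk_det \<noteq> 0" "\<And>u. u < n \<Longrightarrow> (\<Sum>k<n. c k * walk k u) = 0" "k < n"
  shows "c k = 0"
proof (rule fdet_nonzero_kernel_trivial[of n "\<lambda>u k. walk k u" c k])
  show "(\<Sum>k<n. walk k u * c k) = 0" if "u < n" for u
    using assms(2)[OF that] by (simp only: mult.commute[of "walk _ _"])
qed (use assms in \<open>simp_all add: walk_det_def\<close>)

end

section \<open>Primes whose square does not divide the determinant\<close>

context walk_lattice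
begin

text \<open>Composed with the inverse of \<open>f\<close>, a vector orthogonal to the walk vectors
  modulo \<open>p\<close> is a left kernel vector of the walk matrix, and these form at most a
  line.\<close>

lemma orthogonal_mod_prime_dependent:
  assumes p: "prime_elem p" and nd: "\<not> p\<^sup>2 dvd walk_det"
    and x: "\<And>k. k < n \<Longrightarrow> p dvd form x (walk k)"
    and y: "\<And>k. k < n \<Longrightarrow> p dvd form y (walk k)"
    and ij: "i < n" "j < n"
  shows "p dvd x i * y j - y i * x j"
proof -
  define g where "g = inv_into UNIV f"
  have gf: "g (f u) = u" for u
    using permutes_inj[OF perm] by (simp add: g_def)
  have form_g: "(\<Sum>u<n. z (g u) * walk k u) = form z (walk k)" for z k
    using sum_perm[of "\<lambda>u. z (g u) * walk k u"] by (simp add: gf form_def)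
  have "p dvd x (g (f i)) * y (g (f j)) - y (g (f i)) * x (g (f j))"
    by (rule left_kernel_mod_prime_dependent[OF p, of n "\<lambda>u k. walk k u"
          "\<lambda>u. x (g u)" "\<lambda>u. y (g u)"])
      (use nd x y ij in \<open>simp_all add: walk_det_def form_g\<close>)
  thus ?thesis by (simp add: gf)
qed

text \<open>Locally at \<open>p\<close>, where \<open>s\<close> is a unit, the walk lattice is the
  orthogonal of \<open>v\<close> modulo \<open>p\<close>. Up to \<open>f\<close>, the rows of the
  adjugate are left kernel vectors modulo \<open>p\<close>, hence proportional to \<open>v\<close>.
  So the adjugate maps \<open>x\<close> to a multiple of \<open>p\<close>, and applying the walk
  matrix to the quotient returns \<open>s * x\<close>.\<close>

lemma orthogonal_vector_is_walk_combination:
  assumes p: "prime_elem p" and nd: "\<not> p\<^sup>2 dvd walk_det"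
    and v: "\<And>k. k < n \<Longrightarrow> p dvd form v (walk k)" and i: "i < n" "\<not> p dvd v i"
    and s: "walk_det = p * s" and x: "p dvd form v x"
  shows "\<exists>c. \<forall>u<n. s * x u = (\<Sum>k<n. c k * walk k u)"
proof -
  have p0: "p \<noteq> 0" using p by auto
  obtain N where N:
    "\<And>i j. i < n \<Longrightarrow> j < n \<Longrightarrow> (\<Sum>k<n. N i k * walk j k) = (if i = j then walk_det else 0)"
    "\<And>i j. i < n \<Longrightarrow> j < n \<Longrightarrow> (\<Sum>k<n. walk k i * N k j) = (if i = j then walk_det else 0)"
    using that by (rule fdet_adjugate[of n "\<lambda>u k. walk k u", folded walk_det_def])
  define q where "q = (\<lambda>k. \<Sum>u<n. N k u * x u)"
  have "p dvd q k" if k: "k < n" for k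
  proof -
    define r where "r = (\<lambda>u. N k (f u))"
    have "form r (walk j) = (\<Sum>u<n. N k u * walk j u)" for j
      using sum_perm[of "\<lambda>u. N k u * walk j u"] by (simp add: form_def r_def)
    hence r: "p dvd form r (walk j)" if "j < n" for j using N(1)[OF k that] s by simp
    have dep: "p dvd v i * r u - r i * v u" if "u < n" for u
      by (rule orthogonal_mod_prime_dependent[OF p nd v r i(1) that])
    have "v i * (\<Sum>u<n. N k u * x u) = v i * form r x"
      using sum_perm[of "\<lambda>u. N k u * x u"] by (simp add: form_def r_def)
    also have "\<dots> = (\<Sum>u<n. (v i * r u - r i * v u) * x (f u)) + r i * form v x"
      by (simp add: form_def sum_distrib_left left_diff_distrib sum_subtractf mult.assoc)
    finally have "p dvd v i * (\<Sum>u<n. N k u * x u)"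
      using dep x by (auto intro!: dvd_add dvd_sum)
    thus ?thesis using p i by (simp add: prime_elem_dvd_mult_iff q_def)
  qed
  then obtain c where c: "\<And>k. k < n \<Longrightarrow> q k = p * c k"
    unfolding dvd_def by metis
  have "s * x u = (\<Sum>k<n. c k * walk k u)" if u: "u < n" for u
  proof -
    have "p * (\<Sum>k<n. c k * walk k u) = (\<Sum>k<n. walk k u * (\<Sum>j<n. N k j * x j))"
      using c by (simp add: q_def sum_distrib_left[of p] ac_simps)
    also have "\<dots> = (\<Sum>j<n. (\<Sum>k<n. walk k u * N k j) * x j)"
      by (rule sum_sum_swap_mult)
    also have "\<dots> = (\<Sum>j<n. if u = j then walk_det * x j else 0)"
      using N(2)[OF u] by (intro sum.cong) auto
    also have "\<dots> = p * (s * x u)" using u by (simp add: s mult.assoc)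
    finally show ?thesis using p0 by simp
  qed
  thus ?thesis by blast
qed

text \<open>Meant for the columns of l U, where \<open>p\<close> divides the level l. If
  \<open>v\<close> were nonzero modulo \<open>p\<close>, then \<open>v\<close> and \<open>p\<close>
  times a unit vector would both be eigenvectors of \<open>A\<close> on the walk lattice modulo
  \<open>p\<close>, and comparing last coordinates gives a contradiction.\<close>

theorem prime_dvd_isotropic_vector:
  assumes p: "prime_elem p" and nd: "\<not> p\<^sup>2 dvd walk_det"
    and sums: "\<And>k. p dvd (\<Sum>u<n. (app ^^ k) v u)"
    and vv: "p\<^sup>2 dvd form v v" and vAv: "p\<^sup>2 dvd form v (app v)"
    and u: "u < n"
  shows "p dvd v u"
proof (rule ccontr)
  assume ndvd: "\<not> p dvd v u"
  have p0: "p \<noteq> 0" using p by auto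
  have D0: "walk_det \<noteq> 0" using nd by auto
  have v: "p dvd form v (walk k)" for k
    using sums[of k] by (simp add: form_walk_right form_one_right)
  have Av: "p dvd form (app v) (walk k)" for k
    using v[of "Suc k"] by (simp add: form_app)
  define a b where "a = v u" and "b = app v u"
  \<comment> \<open>\<open>T\<close> is a multiple of \<open>A - \<lambda> I\<close>, where \<open>\<lambda> = b / a\<close> is the eigenvalue of \<open>v\<close> modulo \<open>p\<close>.\<close>
  define T where "T = (\<lambda>x w. a * app x w - b * x w)"
  have T_form: "form x (T y) = form (T x) y" for x y
    by (simp add: T_def form_diff_left form_diff_right form_scale_left form_scale_right form_app)
  have Tv: "p dvd T v w" if w: "w < n" for w
    using orthogonal_mod_prime_dependent[OF p nd v Av u w] by (simp add: T_def a_def b_def)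
  \<comment> \<open>Up to \<open>f\<close>, \<open>v\<close> is a nonzero left kernel vector of the
    walk matrix modulo \<open>p\<close>.\<close>
  have ndD: "p dvd walk_det"
  proof -
    obtain N where N: "\<And>i j. i < n \<Longrightarrow> j < n \<Longrightarrow>
        (\<Sum>k<n. walk k i * N k j) = (if i = j then walk_det else 0)"
      using fdet_adjugate[of n "\<lambda>u k. walk k u"] unfolding walk_det_def by metis
    have "(\<Sum>k<n. form v (walk k) * N k (f u)) =
        (\<Sum>w<n. v w * (\<Sum>k<n. walk k (f w) * N k (f u)))"
      unfolding form_def by (rule sum_sum_swap_mult[symmetric])
    also have "\<dots> = (\<Sum>w<n. if w = u then v u * walk_det else 0)"
      using u by (intro sum.cong) (auto simp: N inj_eq[OF permutes_inj[OF perm]])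
    also have "\<dots> = v u * walk_det" using u by simp
    finally have eq: "(\<Sum>k<n. form v (walk k) * N k (f u)) = v u * walk_det" .
    have "p dvd v u * walk_det" unfolding eq[symmetric] using v by (intro dvd_sum dvd_mult2)
    thus ?thesis using p ndvd by (simp add: prime_elem_dvd_mult_iff)
  qed
  then obtain s where s: "walk_det = p * s" by (rule dvdE)
  have ps: "\<not> p dvd s" using nd p0 by (auto simp: s power2_eq_square)
  have span: "\<exists>c. \<forall>u<n. s * x u = (\<Sum>k<n. c k * walk k u)" if "p dvd form v x" for x
    by (rule orthogonal_vector_is_walk_combination[OF p nd v u ndvd s that])
  obtain h where h: "\<And>w. w < n \<Longrightarrow> s * walk n w = (\<Sum>k<n. h k * walk k w)"
    using span[OF v[of n]] by blast
  have n0: "n > 0" using u by simp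
  define l where "l = n - 1"
  have nl: "n = Suc l" using n0 by (simp add: l_def)
  \<comment> \<open>Locally at \<open>p\<close>, \<open>T x\<close> lies in \<open>p\<close> times
    the walk lattice, so \<open>x\<close> is an eigenvector there modulo \<open>p\<close>. In the
    walk basis \<open>A\<close> is a companion matrix, hence an eigenvector is determined by its
    last coordinate.\<close>
  have key: "p dvd c k"
    if sx: "\<And>w. w < n \<Longrightarrow> s * x w = (\<Sum>k<n. c k * walk k w)"
      and Tx: "\<And>w. w < n \<Longrightarrow> T x w = p * z w" and z: "p dvd form v z"
      and last: "p dvd c l" and k: "k < n" for x c z k
  proof -
    obtain d where d: "\<And>w. w < n \<Longrightarrow> s * z w = (\<Sum>k<n. d k * walk k w)"
      using span[OF z] by blast
    obtain c' where c': "c l = p * c'" using last by (rule dvdE)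
    \<comment> \<open>The coordinate at \<open>walk k\<close> of
      \<open>s * s * (T x - p * z)\<close>, with \<open>walk n\<close> rewritten by
      \<open>h\<close>. Modulo \<open>p\<close> only the terms in \<open>c (k - 1)\<close> and
      \<open>c k\<close> remain, so divisibility descends from index \<open>l\<close>.\<close>
    define C where "C = (\<lambda>k. s * a * (if k = 0 then 0 else c (k - 1)) + p * c' * a * h k
        - s * b * c k - s * p * d k)"
    have "C k = 0" if k: "k < n" for k
    proof (rule walk_combination_unique[OF D0 _ k])
      fix w assume w: "w < n"
      have sx': "app (\<lambda>w. s * x w) = app (\<lambda>w. \<Sum>k<n. c k * walk k w)"
        by (rule app_cong) (simp add: sx)
      have "s * app x w = (\<Sum>k<n. c k * walk (Suc k) w)"
        using fun_cong[OF sx', of w] by (simp add: app_scale app_sum)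
      also have "\<dots> = (\<Sum>k<l. c k * walk (Suc k) w) + c l * walk n w"
        by (simp add: nl)
      also have "(\<Sum>k<l. c k * walk (Suc k) w) =
          (\<Sum>k<n. (if k = 0 then 0 else c (k - 1)) * walk k w)"
        unfolding nl by (subst sum.lessThan_Suc_shift) (simp del: walk_Suc)
      finally have sA: "s * app x w = (\<Sum>k<n. (if k = 0 then 0 else c (k - 1)) * walk k w)
          + p * c' * walk n w" by (simp only: c')
      have "(\<Sum>k<n. C k * walk k w) =
          s * a * (\<Sum>k<n. (if k = 0 then 0 else c (k - 1)) * walk k w)
          + p * c' * a * (\<Sum>k<n. h k * walk k w) - s * b * (\<Sum>k<n. c k * walk k w)
          - s * p * (\<Sum>k<n. d k * walk k w)"
        unfolding C_def sum_distrib_left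
        by (simp only: sum.distrib[symmetric] sum_subtractf[symmetric])
          (intro sum.cong refl, simp only: algebra_simps)
      also have "\<dots> = s * a * (s * app x w - p * c' * walk n w)
          + p * c' * a * (s * walk n w) - s * b * (s * x w) - s * p * (s * z w)"
        unfolding sA using w by (simp add: h sx d)
      also have "\<dots> = s * s * (T x w - p * z w)" by (simp add: T_def algebra_simps)
      finally show "(\<Sum>k<n. C k * walk k w) = 0" using Tx[OF w] by simp
    qed
    note C0 = this
    have step: "p dvd c j" if "p dvd c (Suc j)" "Suc j < n" for j
    proof -
      have "s * a * c j = s * b * c (Suc j) + p * (s * d (Suc j) - c' * a * h (Suc j))"
        using C0[OF that(2)] by (simp add: C_def algebra_simps)
      hence "p dvd s * a * c j" using that(1) by simp
      thus ?thesis using p ps ndvd by (simp add: prime_elem_dvd_mult_iff a_def)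
    qed
    have "p dvd c (l - j)" for j
    proof (induction j)
      case (Suc j)
      show ?case
      proof (cases "j < l")
        case True
        hence "Suc (l - Suc j) = l - j" by simp
        thus ?thesis using step[of "l - Suc j"] Suc.IH nl by simp
      next
        case False
        thus ?thesis using Suc.IH by simp
      qed
    qed (use last in simp)
    from this[of "l - k"] show ?thesis using k nl by simp
  qed
  have v_orth: "p dvd form v v" using vv by (metis dvd_mult_left power2_eq_square)
  \<comment> \<open>A unit vector that pairs with \<open>v\<close> to \<open>a\<close>; thus
    \<open>y\<close> is outside the walk lattice at \<open>p\<close>, while \<open>p * y\<close> is
    inside.\<close>
  define y where "y = (\<lambda>w. if w = f u then 1 else (0 :: 'a))"
  have vy: "form v y = a" unfolding y_def a_def by (rule form_delta[OF u])
  obtain z1 where z1: "\<And>w. w < n \<Longrightarrow> T v w = p * z1 w" using Tv unfolding dvd_def by metis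
  \<comment> \<open>Here both congruences modulo the square of \<open>p\<close> are used: they put
    \<open>T v / p\<close> into the walk lattice at \<open>p\<close>.\<close>
  have z1_orth: "p dvd form v z1"
  proof -
    have "p * form v z1 = form v (T v)"
      using form_cong[of v v "\<lambda>w. p * z1 w" "T v"] z1 by (simp add: form_scale_right)
    also have "\<dots> = a * form v (app v) - b * form v v"
      by (simp add: T_def form_diff_right form_scale_right)
    finally have "p * p dvd p * form v z1"
      using vv vAv by (simp add: power2_eq_square dvd_diff)
    thus ?thesis using p0 by simp
  qed
  have Ty_orth: "p dvd form v (T x)" for x
    unfolding T_form unfolding form_def using Tv by (auto intro!: dvd_sum)
  obtain c1 where c1: "\<And>w. w < n \<Longrightarrow> s * v w = (\<Sum>k<n. c1 k * walk k w)"
    using span[OF v_orth] by blast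
  have "p dvd form v (\<lambda>w. p * y w)" by (simp add: form_scale_right)
  from span[OF this] obtain c2 where
    c2: "\<And>w. w < n \<Longrightarrow> s * (p * y w) = (\<Sum>k<n. c2 k * walk k w)" by blast
  have c1l: "\<not> p dvd c1 l"
  proof
    assume "p dvd c1 l"
    hence "p dvd c1 k" if "k < n" for k using key[OF c1 z1 z1_orth _ that] by blast
    hence "p dvd s * v u" using u by (auto simp: c1 intro!: dvd_sum)
    thus False using p ps ndvd by (simp add: prime_elem_dvd_mult_iff)
  qed
  \<comment> \<open>The combination of the two eigenvectors whose last coordinate is zero, so that
    \<open>key\<close> applies.\<close>
  define x where "x = (\<lambda>w. c2 l * v w - c1 l * (p * y w))"
  define c where "c = (\<lambda>k. c2 l * c1 k - c1 l * c2 k)"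
  define z where "z = (\<lambda>w. c2 l * z1 w - c1 l * T y w)"
  have sx: "s * x w = (\<Sum>k<n. c k * walk k w)" if "w < n" for w
    using c1[OF that] c2[OF that]
    by (simp add: x_def c_def sum_subtractf left_diff_distrib right_diff_distrib mult.assoc
        sum_distrib_left[symmetric] mult.left_commute[of s])
  have Tx: "T x w = p * z w" if "w < n" for w
  proof -
    have "T x w = c2 l * T v w - c1 l * (p * T y w)"
      by (simp add: T_def x_def app_diff app_scale algebra_simps)
    thus ?thesis using z1[OF that] by (simp add: z_def algebra_simps)
  qed
  have "p dvd form v z"
    by (simp add: z_def form_diff_right form_scale_right z1_orth Ty_orth dvd_diff)
  hence "p dvd c k" if "k < n" for k
    using key[OF sx Tx _ _ that] by (simp add: c_def mult.commute)
  then obtain c' where c': "\<And>k. k < n \<Longrightarrow> c k = p * c' k" unfolding dvd_def by metis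
  have sx': "s * x w = p * (\<Sum>k<n. c' k * walk k w)" if "w < n" for w
    using sx[OF that] by (simp add: c' sum_distrib_left mult.assoc)
  have "s * (c2 l * v u) = p * ((\<Sum>k<n. c' k * walk k u) + s * c1 l * y u)"
    using sx'[OF u] by (simp add: x_def algebra_simps)
  hence "p dvd s * (c2 l * v u)" by simp
  hence "p dvd c2 l" using p ps ndvd by (simp add: prime_elem_dvd_mult_iff)
  then obtain e where e: "c2 l = p * e" by (rule dvdE)
  \<comment> \<open>As \<open>p dvd c2 l\<close>, the vector \<open>x / p\<close> is integral and
    locally in the walk lattice, so it pairs with \<open>v\<close> to zero modulo \<open>p\<close>;
    but this pairing is \<open>- c1 l * a\<close> modulo \<open>p\<close>.\<close>
  have "p * (s * (e * form v v - c1 l * a)) = form v (\<lambda>w. s * x w)"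
    by (simp add: x_def form_scale_right form_diff_right vy e algebra_simps)
  also have "\<dots> = form v (\<lambda>w. p * (\<Sum>k<n. c' k * walk k w))"
    by (rule form_cong) (simp_all add: sx')
  also have "\<dots> = p * (\<Sum>k<n. c' k * form v (walk k))"
    by (simp add: form_scale_right form_sum_right)
  finally have "s * (e * form v v - c1 l * a) = (\<Sum>k<n. c' k * form v (walk k))"
    using p0 by simp
  hence "p dvd s * (e * form v v - c1 l * a)" using v by (simp add: dvd_sum)
  hence "p dvd e * form v v - c1 l * a" using p ps by (simp add: prime_elem_dvd_mult_iff)
  hence "p dvd c1 l * a" using v_orth by (metis dvd_diff_right_iff dvd_mult)
  thus False using p c1l ndvd by (simp add: prime_elem_dvd_mult_iff a_def)
qed

end

section \<open>The prime \<open>1 + i\<close>\<close>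

text \<open>
  Modulo \<open>1 + i\<close> the ideal \<open>{h. h\<^sup>2 \<in> J}\<close> is principal, with a generator whose square lies in
  \<open>J\<close>; the induction is the Euclidean algorithm over the residue field with two elements.
\<close>

lemma mult_mem_ideal_of_squares_mem:
  fixes J :: "gauss_int poly set"
  assumes add: "\<And>F G. F \<in> J \<Longrightarrow> G \<in> J \<Longrightarrow> F + G \<in> J"
    and mult: "\<And>F G. F \<in> J \<Longrightarrow> G * F \<in> J"
    and pi: "[:1 + gauss_i:] \<in> J"
    and "h1 * h1 \<in> J" "h2 * h2 \<in> J"
  shows "h1 * h2 \<in> J"
proof -
  define \<pi> where "\<pi> = 1 + gauss_i"
  \<comment> \<open>Unlike the degree, this separates zero from the nonzero constants, so every
    reduction step decreases it.\<close>
  define len where "len = (\<lambda>h :: gauss_int poly. if h = 0 then 0 else Suc (degree h))"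
  have pi_mem: "[:\<pi>:] * G \<in> J" for G using mult[OF pi, of G] by (simp add: \<pi>_def mult.commute)
  have two_mem: "2 * G \<in> J" for G
  proof -
    have "2 = [:\<pi>:] * [:1 - gauss_i:]"
      by (simp add: \<pi>_def numeral_poly gauss_int_eq_iff)
    hence "2 * G = [:\<pi>:] * ([:1 - gauss_i:] * G)" by (simp only: mult.assoc)
    thus ?thesis using pi_mem by metis
  qed
  \<comment> \<open>Squaring is additive modulo \<open>2\<close>, and multiples of \<open>2\<close>
    lie in \<open>J\<close> because \<open>\<pi>\<close> divides \<open>2\<close>.\<close>
  have red_sq: "(h - g * h' - [:\<pi>:] * m) * (h - g * h' - [:\<pi>:] * m) \<in> J"
    if "h * h \<in> J" "h' * h' \<in> J" for h h' g m
  proof -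
    have eq: "(h - g * h' - [:\<pi>:] * m) * (h - g * h' - [:\<pi>:] * m) =
        h * h + (g * g) * (h' * h') + 2 * (- (g * h * h'))
        + [:\<pi>:] * ([:\<pi>:] * m * m - 2 * (m * (h - g * h')))"
      by (simp only: algebra_simps mult_2) simp
    show ?thesis
      unfolding eq by (rule add[OF add[OF add[OF that(1) mult[OF that(2)]] two_mem] pi_mem])
  qed
  have red_len: "len (h - g * h' - [:\<pi>:] * monom c (degree h)) < len h"
    if h0: "h \<noteq> 0" and deg: "degree (g * h') \<le> degree h"
      and co: "lead_coeff h - coeff (g * h') (degree h) = \<pi> * c" for h h' g c
  proof -
    define k where "k = h - g * h' - [:\<pi>:] * monom c (degree h)"
    have "degree k \<le> degree h"
      unfolding k_def by (intro degree_diff_le deg order.refl) (simp add: degree_monom_le smult_monom)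
    moreover have "coeff k (degree h) = 0" using co by (simp add: k_def)
    ultimately have "k = 0 \<or> degree k < degree h"
      by (metis le_neq_implies_less leading_coeff_0_iff)
    thus ?thesis using h0 by (auto simp: len_def k_def)
  qed
  have unreduce: "h * h' \<in> J"
    if "h' * h' \<in> J" "(h - g * h' - [:\<pi>:] * m) * h' \<in> J" for h h' g m
  proof -
    have eq: "h * h' = (h - g * h' - [:\<pi>:] * m) * h' + g * (h' * h') + [:\<pi>:] * (m * h')"
      by (simp add: algebra_simps)
    show ?thesis unfolding eq by (rule add[OF add[OF that(2) mult[OF that(1)]] pi_mem])
  qed
  have "h * h' \<in> J" if "h * h \<in> J" "h' * h' \<in> J" "degree h' \<le> degree h" "len h + len h' = N"
    for h h' N
    using that
  proof (induction N arbitrary: h h' rule: less_induct)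
    case (less N)
    have IH: "a * b \<in> J" if "a * a \<in> J" "b * b \<in> J" "len a + len b < N" for a b
    proof (cases "degree b \<le> degree a")
      case True
      thus ?thesis using less.IH[OF that(3)] that by blast
    next
      case False
      hence "b * a \<in> J" using less.IH[of "len b + len a" b a] that by (simp add: add.commute)
      thus ?thesis by (simp add: mult.commute)
    qed
    have z: "0 \<in> J" using pi_mem[of 0] by simp
    consider "h = 0 \<or> h' = 0" | "h \<noteq> 0" "h' \<noteq> 0" "\<pi> dvd lead_coeff h"
      | "h \<noteq> 0" "h' \<noteq> 0" "\<pi> dvd lead_coeff h'"
      | "h \<noteq> 0" "h' \<noteq> 0" "\<not> \<pi> dvd lead_coeff h" "\<not> \<pi> dvd lead_coeff h'" by blast
    thus ?case
    proof cases
      case 1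
      thus ?thesis using z by auto
    next
      case 2
      from 2(3) obtain c where c: "lead_coeff h = \<pi> * c" by (rule dvdE)
      have "(h - 0 * h' - [:\<pi>:] * monom c (degree h)) * h' \<in> J"
        by (rule IH[OF red_sq]) (use less.prems red_len[of h 0 h' c] 2 c in auto)
      thus ?thesis using unreduce less.prems by blast
    next
      case 3
      from 3(3) obtain c where c: "lead_coeff h' = \<pi> * c" by (rule dvdE)
      have "(h' - 0 * h - [:\<pi>:] * monom c (degree h')) * h \<in> J"
        by (rule IH[OF red_sq]) (use less.prems red_len[of h' 0 h c] 3 c in auto)
      hence "h' * h \<in> J" using unreduce less.prems by blast
      thus ?thesis by (simp add: mult.commute)
    next
      case 4
      \<comment> \<open>Both leading coefficients are 1 in the residue field of two elements, so a
        monomial with coefficient 1 cancels them modulo \<open>\<pi>\<close>.\<close>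
      define g where "g = monom (1 :: gauss_int) (degree h - degree h')"
      have gh: "coeff (g * h') (degree h) = lead_coeff h'"
        using less.prems(3) by (simp add: g_def coeff_monom_mult)
      have "\<pi> dvd lead_coeff h - lead_coeff h'"
        using 4(3,4) by (auto simp: \<pi>_def one_plus_i_dvd_iff)
      then obtain c where c: "lead_coeff h - coeff (g * h') (degree h) = \<pi> * c"
        unfolding gh by (rule dvdE)
      have "degree (g * h') \<le> degree h"
        using degree_mult_le[of g h'] less.prems(3)
          degree_monom_le[of "1 :: gauss_int" "degree h - degree h'"]
        unfolding g_def by linarith
      hence "(h - g * h' - [:\<pi>:] * monom c (degree h)) * h' \<in> J"
        by (intro IH[OF red_sq]) (use less.prems red_len[of h g h' c] 4 c in auto)
      thus ?thesis using unreduce less.prems by blast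
    qed
  qed
  hence *: "h * h' \<in> J" if "h * h \<in> J" "h' * h' \<in> J" "degree h' \<le> degree h" for h h'
    using that by blast
  show ?thesis
  proof (cases "degree h2 \<le> degree h1")
    case False
    hence "h2 * h1 \<in> J" using * assms by simp
    thus ?thesis by (simp add: mult.commute)
  qed (use * assms in blast)
qed

section \<open>Polynomials in A applied to the all-one vector\<close>

context walk_lattice
begin

text \<open>This is the vector F(A) e, and \<open>functional\<close> is the scalar e^T F(A)
  e.\<close>

definition walk_poly :: "'a poly \<Rightarrow> nat \<Rightarrow> 'a" where
  "walk_poly F u = (\<Sum>k\<le>degree F. coeff F k * walk k u)"

definition functional :: "'a poly \<Rightarrow> 'a" where
  "functional F = (\<Sum>u<n. walk_poly F u)"

lemma walk_poly_eq:
  assumes "degree F \<le> N"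
  shows "walk_poly F u = (\<Sum>k\<le>N. coeff F k * walk k u)"
  unfolding walk_poly_def
  by (rule sum.mono_neutral_left) (use assms in \<open>auto simp: coeff_eq_0\<close>)

lemma walk_poly_0 [simp]: "walk_poly 0 = (\<lambda>_. 0)"
  by (rule ext) (simp add: walk_poly_def)

lemma walk_poly_add: "walk_poly (F + G) = (\<lambda>u. walk_poly F u + walk_poly G u)"
proof
  fix u
  define N where "N = max (degree F) (degree G)"
  have "degree (F + G) \<le> N" "degree F \<le> N" "degree G \<le> N"
    by (auto simp: N_def degree_add_le)
  thus "walk_poly (F + G) u = walk_poly F u + walk_poly G u"
    by (simp add: walk_poly_eq[of _ N] distrib_right sum.distrib)
qed

lemma walk_poly_smult: "walk_poly (smult c F) = (\<lambda>u. c * walk_poly F u)"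
proof
  fix u
  have "degree (smult c F) \<le> degree F" by (rule degree_smult_le)
  thus "walk_poly (smult c F) u = c * walk_poly F u"
    by (simp only: walk_poly_eq[of _ "degree F"] order.refl)
      (simp add: sum_distrib_left mult.assoc)
qed

lemma walk_poly_pCons: "walk_poly (pCons a F) = (\<lambda>u. a + app (walk_poly F) u)"
proof
  fix u
  have "degree (pCons a F) \<le> Suc (degree F)" by (rule degree_pCons_le)
  hence "walk_poly (pCons a F) u = (\<Sum>k\<le>Suc (degree F). coeff (pCons a F) k * walk k u)"
    by (rule walk_poly_eq)
  also have "\<dots> = a + (\<Sum>k\<le>degree F. coeff F k * walk (Suc k) u)"
    by (subst sum.atMost_Suc_shift) (simp del: walk_Suc)
  also have "(\<Sum>k\<le>degree F. coeff F k * walk (Suc k) u) = app (walk_poly F) u"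
    unfolding walk_poly_def by (simp add: app_sum app_scale)
  finally show "walk_poly (pCons a F) u = a + app (walk_poly F) u" .
qed

lemma walk_poly_monom: "walk_poly (monom c k) = (\<lambda>u. c * walk k u)"
  by (induction k) (simp_all add: monom_0 monom_Suc walk_poly_pCons app_scale, simp add: app_def)

lemma walk_poly_sum: "walk_poly (\<Sum>k\<in>K. F k) = (\<lambda>u. \<Sum>k\<in>K. walk_poly (F k) u)"
  by (induction K rule: infinite_finite_induct) (auto simp: walk_poly_add)

lemma walk_poly_monom_mult: "walk_poly (monom 1 k * F) = (app ^^ k) (walk_poly F)"
  by (induction k) (simp_all add: monom_0 monom_Suc walk_poly_pCons)

lemma functional_add: "functional (F + G) = functional F + functional G"
  by (simp add: functional_def walk_poly_add sum.distrib)

lemma functional_smult: "functional (smult c F) = c * functional F"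
  by (simp add: functional_def walk_poly_smult sum_distrib_left)

lemma functional_monom: "functional (monom c k) = c * moment k"
  by (simp add: functional_def walk_poly_monom moment_def sum_distrib_left)

text \<open>Self-adjointness moves F(A) to the right argument, and pairing with e sums the
  coordinates. Orthogonality thus becomes a statement about products of polynomials.\<close>

lemma form_walk_poly: "form (walk_poly F) (walk_poly G) = functional (F * G)"
proof (induction F arbitrary: G)
  case 0
  show ?case by (simp add: form_def functional_def)
next
  case (pCons a F)
  have "form (walk_poly (pCons a F)) (walk_poly G) =
      form (\<lambda>u. a * 1) (walk_poly G) + form (walk_poly F) (app (walk_poly G))"
    by (simp add: walk_poly_pCons form_add_left form_app)
  also have "form (\<lambda>u. a * 1) (walk_poly G) = functional (smult a G)"
    by (simp only: form_scale_left form_one_left functional_smult) (simp add: functional_def)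
  also have "app (walk_poly G) = walk_poly (pCons 0 G)" by (simp add: walk_poly_pCons)
  also have "form (walk_poly F) \<dots> = functional (F * pCons 0 G)" by (rule pCons.IH)
  finally show ?case by (simp add: functional_add)
qed

lemma functional_monom_mult:
  "functional (monom 1 k * (F * G)) = form (walk_poly F) ((app ^^ k) (walk_poly G))"
proof -
  have "monom 1 k * (F * G) = F * (monom 1 k * G)" by (simp add: mult.left_commute)
  thus ?thesis by (simp only: form_walk_poly[of F "monom 1 k * G", symmetric] walk_poly_monom_mult)
qed

text \<open>The largest ideal on which \<open>functional\<close> is divisible by \<open>m\<close>.
  Testing against all monomials makes F(A) e orthogonal to all walk vectors modulo
  \<open>m\<close>.\<close>

definition functional_ideal :: "'a \<Rightarrow> 'a poly set" where
  "functional_ideal m = {F. \<forall>k. m dvd functional (monom 1 k * F)}"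

lemma functional_ideal_add:
  "F \<in> functional_ideal m \<Longrightarrow> G \<in> functional_ideal m \<Longrightarrow> F + G \<in> functional_ideal m"
  by (simp add: functional_ideal_def distrib_left functional_add)

lemma functional_ideal_mult:
  assumes F: "F \<in> functional_ideal m"
  shows "G * F \<in> functional_ideal m"
proof -
  have "m dvd functional (monom 1 k * (G * F))" for k
  proof (induction G arbitrary: k)
    case 0
    show ?case by (simp add: functional_def)
  next
    case (pCons a G)
    have "monom 1 k * (pCons a G * F) = smult a (monom 1 k * F) + monom 1 (Suc k) * (G * F)"
      by (simp add: distrib_left monom_Suc)
    thus ?case using pCons.IH[of "Suc k"] F
      by (simp add: functional_add functional_smult functional_ideal_def)
  qed
  thus ?thesis by (simp add: functional_ideal_def)
qed

end

section \<open>Hermitian symmetry and the parity of the moments\<close>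

lemma fdet_scale_rows: "fdet n (\<lambda>i j. d i * M i j) = (\<Prod>i<n. d i) * fdet n M"
proof -
  define D where "D = mat n n (\<lambda>(i, j). if i = j then d i else 0)"
  have "det D = prod_list (diag_mat D)"
    by (rule det_upper_triangular[of _ n]) (auto simp: D_def)
  also have "\<dots> = (\<Prod>i<n. d i)"
    by (simp add: prod_list_diag_prod D_def lessThan_atLeast0)
  finally have D: "fdet n (\<lambda>i j. if i = j then d i else 0) = (\<Prod>i<n. d i)"
    by (simp add: fdet_def D_def)
  have "fdet n (\<lambda>i j. d i * M i j) = fdet n (\<lambda>i j. \<Sum>k<n. (if i = k then d i else 0) * M k j)"
    by (rule fdet_cong) (simp add: if_distrib[of "\<lambda>x. x * _"] cong: if_cong)
  also have "\<dots> = (\<Prod>i<n. d i) * fdet n M" by (simp only: fdet_mult D)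
  finally show ?thesis .
qed

text \<open>Transposed entries add up to twice a real part.\<close>

lemma two_dvd_hermitian_sum:
  fixes n :: nat
  assumes "\<And>u v. u < n \<Longrightarrow> v < n \<Longrightarrow> h v u = gauss_cnj (h u v)" "\<And>u. u < n \<Longrightarrow> h u u = 0"
  shows "2 dvd (\<Sum>u<n. \<Sum>v<n. h u v)"
  using assms
proof (induction n)
  case (Suc n)
  have off: "2 dvd h u n + h n u" if "u < n" for u
    using Suc.prems(1)[of u n] that by (simp add: two_dvd_gauss_iff)
  have "2 dvd (\<Sum>u<n. \<Sum>v<n. h u v)"
  proof (rule Suc.IH)
    show "h v u = gauss_cnj (h u v)" if "u < n" "v < n" for u v
      by (rule Suc.prems(1)) (use that in simp_all)
  qed (simp add: Suc.prems(2))
  hence "2 dvd (\<Sum>u<n. \<Sum>v<n. h u v) + (\<Sum>u<n. h u n + h n u)"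
    by (rule dvd_add[OF _ dvd_sum]) (use off in auto)
  thus ?case using Suc.prems(2)[of n] by (simp add: sum.distrib ac_simps)
qed simp

locale hermitian_walk_lattice = walk_lattice n A f
  for n :: nat and A :: "nat \<Rightarrow> nat \<Rightarrow> gauss_int" and f +
  assumes hermitian: "\<And>u v. u < n \<Longrightarrow> v < n \<Longrightarrow> gauss_cnj (A u v) = A v u"
    and zero_diag: "\<And>u. u < n \<Longrightarrow> A u u = 0"
begin

text \<open>Conjugation transposes \<open>A\<close>, which amounts to relabelling by
  \<open>f\<close>, and the all-one vector is invariant under both.\<close>

lemma cnj_walk: "u < n \<Longrightarrow> gauss_cnj (walk k u) = walk k (f u)"
proof (induction k arbitrary: u)
  case (Suc k)
  have "gauss_cnj (walk (Suc k) u) = (\<Sum>v<n. A (f u) (f v) * walk k (f v))"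
    using Suc by (simp add: app_def gauss_cnj.hom_sum gauss_cnj.hom_mult hermitian converse[symmetric])
  also have "\<dots> = walk (Suc k) (f u)"
    by (simp add: app_def sum_perm[of "\<lambda>v. A (f u) v * walk k v"])
  finally show ?case .
qed (simp add: gauss_cnj.hom_one)

lemma cnj_moment: "gauss_cnj (moment k) = moment k"
  by (simp add: moment_def gauss_cnj.hom_sum cnj_walk sum_perm)

text \<open>For k = 2 j the moment is the sum of the norms of the entries of \<open>walk j\<close>;
  since a norm z cnj(z) is congruent to z modulo 1 + i, this reduces to \<open>moment j\<close>. For
  odd \<open>k\<close> it is a Hermitian form with zero diagonal.\<close>

lemma two_dvd_moment: "k > 0 \<Longrightarrow> 2 dvd moment k"
proof (induction k rule: less_induct)
  case (less k)
  show ?case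
  proof (cases "even k")
    case True
    then obtain j where j: "k = j + j" by (metis evenE mult_2)
    have "moment k - moment j = form (walk j) (walk j) - moment j"
      by (simp add: form_walk_walk j)
    also have "\<dots> = (\<Sum>u<n. walk j u * gauss_cnj (walk j u) - walk j u)"
      by (simp add: form_def moment_def cnj_walk sum_subtractf)
    also have "1 + gauss_i dvd \<dots>"
      by (intro dvd_sum) (auto simp: one_plus_i_dvd_iff)
    finally have "1 + gauss_i dvd moment k - moment j" .
    moreover have "1 + gauss_i dvd moment j"
      using less j one_plus_i_dvd_2 dvd_trans by (metis add_gr_0 less_add_same_cancel1)
    ultimately have "1 + gauss_i dvd moment k"
      by (metis diff_add_cancel dvd_add)
    \<comment> \<open>A rational integer divisible by 1 + i is even.\<close>
    moreover have "ImZ (moment k) = 0" using cnj_moment[of k] by (simp add: gauss_int_eq_iff)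
    ultimately show ?thesis by (simp add: one_plus_i_dvd_iff two_dvd_gauss_iff)
  next
    case False
    then obtain j where j: "k = j + Suc j" by (metis oddE add_Suc_right mult_2 Suc_eq_plus1)
    have "moment k = form (walk j) (app (walk j))"
      using form_walk_walk[of j "Suc j"] by (simp add: j)
    also have "\<dots> = (\<Sum>u<n. walk j u * (\<Sum>v<n. A (f u) (f v) * walk j (f v)))"
      by (simp add: form_def app_def sum_perm[of "\<lambda>v. A (f _) v * walk j v"])
    also have "\<dots> = (\<Sum>u<n. \<Sum>v<n. walk j u * A v u * gauss_cnj (walk j v))"
      by (simp add: sum_distrib_left cnj_walk converse[symmetric] mult.assoc)
    also have "2 dvd \<dots>"
      by (rule two_dvd_hermitian_sum)
        (auto simp: zero_diag gauss_cnj.hom_mult hermitian)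
    finally show ?thesis .
  qed
qed

lemma walk_det_cnj: "gauss_cnj walk_det = walk_det \<or> gauss_cnj walk_det = - walk_det"
proof -
  have "gauss_cnj walk_det = fdet n (\<lambda>u k. gauss_cnj (walk k u))"
    unfolding walk_det_def fdet_def gauss_cnj.hom_det[symmetric]
    by (rule arg_cong[of _ _ det]) (auto intro!: eq_matI)
  also have "\<dots> = fdet n (\<lambda>u k. walk k (f u))" by (rule fdet_cong) (simp add: cnj_walk)
  finally show ?thesis
    using fdet_permute_rows[OF perm, of "\<lambda>u k. walk k u"] by (simp add: walk_det_def)
qed

text \<open>The Gram matrix is the transposed walk matrix times a row permutation of the walk
  matrix.\<close>

lemma moment_det: "fdet n (\<lambda>i j. moment (i + j)) \<in> {walk_det\<^sup>2, - walk_det\<^sup>2}"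
proof -
  have "fdet n (\<lambda>i j. moment (i + j)) = fdet n (\<lambda>i j. \<Sum>u<n. walk i u * walk j (f u))"
    by (simp add: form_walk_walk[symmetric] form_def)
  also have "\<dots> = fdet n walk * fdet n (\<lambda>u k. walk k (f u))" by (rule fdet_mult)
  also have "fdet n walk = walk_det" using fdet_transpose[of n walk] by (simp add: walk_det_def)
  finally show ?thesis
    using fdet_permute_rows[OF perm, of "\<lambda>u k. walk k u"]
    by (auto simp: walk_det_def power2_eq_square)
qed

text \<open>
  The Gram matrix of the walk vectors is even except for the entry \<open>n\<close> at \<open>(0, 0)\<close>;
  dividing its rows by the following factors leaves a matrix whose determinant is \<open>\<plusminus>d\<^sup>2\<close>.
\<close>

definition row_factor :: "nat \<Rightarrow> gauss_int" where
  "row_factor i = (if i = 0 \<and> odd n then 1 else 2)"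

lemma row_factor_dvd_moment: "row_factor i dvd moment (i + j)"
proof (cases "i + j = 0")
  case True
  have "moment 0 = of_nat n" by (simp add: moment_def)
  thus ?thesis using True by (auto simp: row_factor_def elim!: evenE)
qed (auto simp: row_factor_def intro!: two_dvd_moment)

text \<open>The exponent is \<open>n\<close> or \<open>n - 1\<close> by parity, exactly the power of
  two to be removed from the square of \<open>walk_det\<close>.\<close>

lemma prod_row_factor: "(\<Prod>i<n. row_factor i) = 2 ^ (2 * (n div 2))"
proof (cases "even n")
  case True
  thus ?thesis by (simp add: row_factor_def)
next
  case False
  then obtain m where m: "n = Suc (2 * m)" by (metis oddE Suc_eq_plus1)
  have "(\<Prod>i<n. row_factor i) = (\<Prod>i<2 * m. row_factor (Suc i))"
    using prod.lessThan_Suc_shift[of row_factor "2 * m"] False by (simp add: row_factor_def flip: m)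
  also have "\<dots> = 2 ^ (2 * m)" by (simp add: row_factor_def)
  finally show ?thesis by (simp add: m)
qed

text \<open>The coordinates of \<open>s * x\<close> come from the adjugate of the divided Gram
  matrix, whose determinant is \<open>s\<close>; the error is orthogonal to all walk vectors, hence
  zero. At primes not dividing \<open>d\<close> the walk lattice thus contains every vector with
  these divisible pairings.\<close>

lemma even_vector_is_walk_combination:
  assumes det: "walk_det = 2 ^ (n div 2) * d" and d0: "d \<noteq> 0"
  shows "\<exists>s \<in> {d\<^sup>2, - d\<^sup>2}. \<forall>x. (\<forall>i<n. row_factor i dvd form (walk i) x) \<longrightarrow>
    (\<exists>F. \<forall>u<n. s * x u = walk_poly F u)"
proof -
  obtain M where M: "\<And>i j. moment (i + j) = row_factor i * M i j"
    using row_factor_dvd_moment unfolding dvd_def by metis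
  define s where "s = fdet n M"
  have "2 ^ (2 * (n div 2)) * s = fdet n (\<lambda>i j. moment (i + j))"
    by (simp add: M fdet_scale_rows prod_row_factor s_def)
  also have "\<dots> \<in> {2 ^ (2 * (n div 2)) * d\<^sup>2, 2 ^ (2 * (n div 2)) * (- d\<^sup>2)}"
    using moment_det by (simp add: det power_mult_distrib power_mult[symmetric] mult.commute)
  finally have s: "s \<in> {d\<^sup>2, - d\<^sup>2}"
    by (auto simp only: insert_iff empty_iff mult_cancel_left power_eq_0_iff gauss_int_two_neq_0)
  have W0: "walk_det \<noteq> 0" using det d0 by simp
  obtain N where N: "\<And>i j. i < n \<Longrightarrow> j < n \<Longrightarrow>
      (\<Sum>k<n. M i k * N k j) = (if i = j then s else 0)"
    using fdet_adjugate[of n M] unfolding s_def by metis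
  have "\<exists>F. \<forall>u<n. s * x u = walk_poly F u" if x: "\<forall>i<n. row_factor i dvd form (walk i) x" for x
  proof -
    obtain z where z: "\<And>i. i < n \<Longrightarrow> form (walk i) x = row_factor i * z i"
      using x unfolding dvd_def by metis
    define c where "c = (\<lambda>k. \<Sum>j<n. N k j * z j)"
    define F where "F = (\<Sum>k<n. monom (c k) k)"
    have F: "walk_poly F = (\<lambda>u. \<Sum>k<n. c k * walk k u)"
      by (simp add: F_def walk_poly_sum walk_poly_monom)
    define y where "y = (\<lambda>u. s * x u - walk_poly F u)"
    have "form (walk i) y = 0" if i: "i < n" for i
    proof -
      have "form (walk i) (walk_poly F) = (\<Sum>k<n. c k * moment (i + k))"
        by (simp add: F form_sum_right form_scale_right form_walk_walk)
      also have "\<dots> = row_factor i * (\<Sum>k<n. M i k * c k)"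
        by (simp only: M sum_distrib_left mult.commute mult.left_commute)
      also have "(\<Sum>k<n. M i k * c k) = (\<Sum>j<n. (\<Sum>k<n. M i k * N k j) * z j)"
        unfolding c_def by (rule sum_sum_swap_mult)
      also have "\<dots> = (\<Sum>j<n. if i = j then s * z j else 0)"
        using N[OF i] by (intro sum.cong) auto
      also have "\<dots> = s * z i" using i by simp
      finally show ?thesis using z[OF i]
        by (simp add: y_def form_diff_right form_scale_right mult.left_commute)
    qed
    hence "(\<Sum>u<n. walk i u * y (f u)) = 0" if "i < n" for i
      using that by (simp add: form_def)
    hence yf: "y (f u) = 0" if "u < n" for u
      using fdet_nonzero_kernel_trivial[of n walk "\<lambda>u. y (f u)", OF _ _ that] W0
        fdet_transpose[of n walk] by (simp add: walk_det_def)
    have "s * x u = walk_poly F u" if u: "u < n" for u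
    proof -
      obtain w where "w < n" "u = f w" using perm_surj[OF u] by blast
      thus ?thesis using yf[of w] by (simp add: y_def)
    qed
    thus ?thesis by blast
  qed
  with s show ?thesis by blast
qed

text \<open>Meant for the columns of l U when \<open>2 dvd l\<close>. Up to the unit
  \<open>s\<close> at 1 + i, \<open>v\<close> and twice a unit vector come from polynomials with
  squares in \<open>J\<close>. Their product is then in \<open>J\<close> as well, so the pairing
  \<open>2 * v u\<close> of the two vectors is divisible by \<open>2 * \<pi>\<close>.\<close>

theorem one_plus_i_dvd_isotropic_vector:
  assumes det: "walk_det = 2 ^ (n div 2) * d" and d: "\<not> 1 + gauss_i dvd d"
    and sums: "\<And>k. 2 dvd (\<Sum>u<n. (app ^^ k) v u)"
    and iso: "\<And>k. 4 dvd form v ((app ^^ k) v)"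
    and u: "u < n"
  shows "1 + gauss_i dvd v u"
proof -
  define \<pi> where "\<pi> = 1 + gauss_i"
  have pi: "prime_elem \<pi>" unfolding \<pi>_def by (rule prime_elem_one_plus_i)
  have pi4: "2 * \<pi> dvd 4"
  proof -
    have "4 = 2 * \<pi> * (1 - gauss_i)" by (simp add: \<pi>_def gauss_int_eq_iff)
    thus ?thesis by (metis dvd_triv_left)
  qed
  have "d \<noteq> 0" using d by auto
  from even_vector_is_walk_combination[OF det this] obtain s where s: "s \<in> {d\<^sup>2, - d\<^sup>2}"
    and span: "\<And>x. \<forall>i<n. row_factor i dvd form (walk i) x \<Longrightarrow> \<exists>F. \<forall>u<n. s * x u = walk_poly F u"
    by blast
  have ps: "\<not> \<pi> dvd s"
    using s d pi by (auto simp: \<pi>_def power2_eq_square prime_elem_dvd_mult_iff)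
  have rf2: "row_factor i dvd 2" for i by (simp add: row_factor_def)
  define y where "y = (\<lambda>w. 2 * (if w = f u then 1 else (0 :: gauss_int)))"
  have "row_factor i dvd form (walk i) v" for i
    using sums[of i] rf2[of i] dvd_trans by (auto simp: form_walk_left)
  then obtain F1 where F1: "\<And>u. u < n \<Longrightarrow> s * v u = walk_poly F1 u" using span by blast
  have "row_factor i dvd form (walk i) y" for i
    using rf2[of i] by (simp add: y_def form_scale_right)
  then obtain F2 where F2: "\<And>u. u < n \<Longrightarrow> s * y u = walk_poly F2 u" using span by blast
  have app_pow: "(app ^^ k) (\<lambda>u. c * x u) = (\<lambda>u. c * (app ^^ k) x u)" for k c x
    by (induction k) (simp_all add: app_scale)
  have pow_cong: "(app ^^ k) x w = (app ^^ k) x' w"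
    if "\<And>u. u < n \<Longrightarrow> x u = x' u" "w < n" for k x x' w
    using app_cong[of x x'] that
    by (cases k) (simp_all add: funpow_Suc_right del: funpow.simps(2))
  define J where "J = functional_ideal (2 * \<pi>)"
  have J_sq: "F * F \<in> J"
    if "\<And>u. u < n \<Longrightarrow> s * x u = walk_poly F u" "\<And>k. 4 dvd form x ((app ^^ k) x)" for F x
  proof -
    have "functional (monom 1 k * (F * F)) = s * s * form x ((app ^^ k) x)" for k
    proof -
      have "functional (monom 1 k * (F * F)) = form (\<lambda>u. s * x u) ((app ^^ k) (\<lambda>u. s * x u))"
        unfolding functional_monom_mult
        by (rule form_cong) (use that(1) in \<open>auto intro!: pow_cong\<close>)
      thus ?thesis by (simp add: app_pow form_scale_left form_scale_right mult.assoc)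
    qed
    thus ?thesis using dvd_trans[OF pi4 that(2)]
      by (auto simp: J_def functional_ideal_def intro!: dvd_mult)
  qed
  have F1J: "F1 * F1 \<in> J" by (rule J_sq[OF F1 iso])
  have F2J: "F2 * F2 \<in> J"
    by (rule J_sq[OF F2]) (simp_all add: y_def app_pow form_scale_left form_scale_right)
  have J_add: "F + G \<in> J" if "F \<in> J" "G \<in> J" for F G
    using that unfolding J_def by (rule functional_ideal_add)
  have J_mult: "G * F \<in> J" if "F \<in> J" for F G
    using that unfolding J_def by (rule functional_ideal_mult)
  have "F1 * F2 \<in> J"
  proof (cases "even n")
    case True
    have m0: "2 dvd moment 0" using True by (auto simp: moment_def elim!: evenE)
    have "2 dvd moment k" for k using two_dvd_moment[of k] m0 by (cases "k = 0") auto
    hence "[:\<pi>:] \<in> J"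
      by (auto simp: J_def functional_ideal_def functional_smult functional_monom mult.commute
          intro!: mult_dvd_mono)
    thus ?thesis using mult_mem_ideal_of_squares_mem[OF J_add J_mult _ F1J F2J]
      by (simp add: \<pi>_def)
  next
    case False
    \<comment> \<open>For odd \<open>n\<close> the constant \<open>\<pi>\<close> is not in
      \<open>J\<close>, but \<open>X * [:\<pi>:]\<close> is. Both polynomials are therefore written
      as a multiple of \<open>X\<close> plus an even constant.\<close>
    define X where "X = monom (1 :: gauss_int) 1"
    \<comment> \<open>Only \<open>moment 0 = n\<close> is odd, so \<open>functional F\<close> has
      the parity of the constant coefficient.\<close>
    have split: "\<exists>h c. F = X * h + [:2 * c:]" if "2 dvd functional F" for F
    proof (cases F)
      case (pCons a h)
      have "F = monom a 0 + X * h" by (simp add: pCons X_def monom_Suc monom_0)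
      hence "functional F = a * moment 0 + functional (X * h)"
        by (simp only: functional_add functional_monom)
      moreover have "2 dvd functional (X * h)"
      proof -
        have "X * h = (\<Sum>k\<le>degree h. monom (coeff h k) (Suc k))"
          by (subst poly_as_sum_of_monoms[of h, symmetric])
            (simp add: X_def sum_distrib_left mult_monom)
        hence "functional (X * h) = (\<Sum>k\<le>degree h. coeff h k * moment (Suc k))"
          by (simp add: functional_def walk_poly_sum walk_poly_monom moment_def
              sum_distrib_left sum.swap[of _ "{..<n}"])
        thus ?thesis by (auto intro!: dvd_sum dvd_mult two_dvd_moment)
      qed
      ultimately have "2 dvd a * moment 0" using that by (metis dvd_add_left_iff)
      moreover have "a * moment 0 = a + 2 * (of_nat (n div 2) * a)"
      proof -
        have "moment 0 = of_nat (2 * (n div 2) + 1)" using False by (simp add: moment_def)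
        thus ?thesis by (simp add: algebra_simps)
      qed
      ultimately have "2 dvd a" by (metis dvd_add_left_iff dvd_triv_left)
      then obtain c where "a = 2 * c" by (rule dvdE)
      hence "F = X * h + [:2 * c:]" by (simp add: pCons X_def monom_Suc monom_0)
      thus ?thesis by blast
    qed
    have fun_even: "2 dvd functional F" if "\<And>u. u < n \<Longrightarrow> s * x u = walk_poly F u"
      "2 dvd (\<Sum>u<n. x u)" for F x
      using that by (simp add: functional_def sum_distrib_left[symmetric] flip: that(1))
    obtain h1 c1 where h1: "F1 = X * h1 + [:2 * c1:]"
      using split[OF fun_even[OF F1]] sums[of 0] by auto
    have "2 dvd (\<Sum>u<n. y u)" by (simp add: y_def sum_distrib_left[symmetric])
    then obtain h2 c2 where h2: "F2 = X * h2 + [:2 * c2:]"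
      using split[OF fun_even[OF F2]] by auto
    have piX: "X * [:\<pi>:] \<in> J"
      using two_dvd_moment
      by (auto simp: J_def functional_ideal_def X_def mult_monom functional_smult functional_monom
          smult_monom mult.commute intro!: mult_dvd_mono)
    have twoX: "X * G * [:2:] \<in> J" for G
    proof -
      have "[:2:] = [:1 - gauss_i:] * [:\<pi>:]" by (simp add: \<pi>_def gauss_int_eq_iff)
      hence eq: "X * G * [:2:] = (G * [:1 - gauss_i:]) * (X * [:\<pi>:])" by (simp only: mult_ac)
      show ?thesis unfolding eq by (rule J_mult[OF piX])
    qed
    have four: "[:4:] \<in> J"
      using pi4 by (auto simp: J_def functional_ideal_def functional_smult intro: dvd_mult2)
    have prod: "(X * h + [:2 * c:]) * (X * h' + [:2 * c':]) =
        X * X * (h * h') + X * (h * [:c':] + h' * [:c:]) * [:2:] + [:c * c':] * [:4:]" for h h' c c'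
      by (simp add: algebra_simps smult_add_left[symmetric])
    have neg: "- F \<in> J" if "F \<in> J" for F using J_mult[OF that, of "- 1"] by simp
    have sqJ: "X * X * (h * h') \<in> J \<longleftrightarrow> (X * h + [:2 * c:]) * (X * h' + [:2 * c':]) \<in> J"
      for h h' c c'
    proof -
      define R where "R = X * (h * [:c':] + h' * [:c:]) * [:2:] + [:c * c':] * [:4:]"
      have R: "R \<in> J" unfolding R_def by (intro J_add twoX J_mult four)
      have eq: "(X * h + [:2 * c:]) * (X * h' + [:2 * c':]) = X * X * (h * h') + R"
        unfolding prod R_def by (simp only: add.assoc)
      show ?thesis unfolding eq using J_add[OF _ R] J_add[OF _ neg[OF R]]
        by (metis add_diff_cancel_right' diff_conv_add_uminus)
    qed
    \<comment> \<open>Dividing out \<open>X * X\<close> gives an ideal that does contain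
      \<open>\<pi>\<close>, so the lemma on squares applies to the cofactors \<open>h1\<close> and
      \<open>h2\<close>.\<close>
    define J' where "J' = {F. X * X * F \<in> J}"
    have "h1 * h2 \<in> J'"
    proof (rule mult_mem_ideal_of_squares_mem)
      show "[:1 + gauss_i:] \<in> J'"
        using J_mult[OF piX, of X] by (simp add: J'_def \<pi>_def mult.assoc)
      show "h1 * h1 \<in> J'" using F1J sqJ[of h1 h1] by (simp add: J'_def h1)
      show "h2 * h2 \<in> J'" using F2J sqJ[of h2 h2] by (simp add: J'_def h2)
      show "F + G \<in> J'" if "F \<in> J'" "G \<in> J'" for F G
        using J_add that by (simp add: J'_def distrib_left)
      show "G * F \<in> J'" if "F \<in> J'" for F G
        using J_mult[of "X * X * F" G] that by (simp add: J'_def mult.left_commute)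
    qed
    thus ?thesis using sqJ[of h1 h2] by (simp add: J'_def h1 h2)
  qed
  hence "2 * \<pi> dvd functional (monom 1 0 * (F1 * F2))"
    by (simp only: J_def functional_ideal_def mem_Collect_eq)
  also have "functional (monom 1 0 * (F1 * F2)) = form (\<lambda>u. s * v u) (\<lambda>u. s * y u)"
    unfolding functional_monom_mult by (rule form_cong) (simp_all add: F1 F2)
  also have "\<dots> = 2 * (s * s * v u)"
    by (simp add: y_def form_scale_left form_scale_right form_delta[OF u] ac_simps)
  finally have "\<pi> dvd s * s * v u" by simp
  thus ?thesis using ps pi by (simp add: prime_elem_dvd_mult_iff \<pi>_def)
qed

end

section \<open>The level\<close>

lemma gauss_int_mat_smult_iff:
  assumes "U \<in> carrier_mat m n"
  shows "gauss_int_mat (c \<cdot>\<^sub>m U) \<longleftrightarrow> (\<forall>i<m. \<forall>j<n. c * U $$ (i, j) \<in> range of_gauss)"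
proof -
  have C: "c \<cdot>\<^sub>m U \<in> carrier_mat m n" using assms by simp
  show ?thesis
  proof
    assume int: "gauss_int_mat (c \<cdot>\<^sub>m U)"
    have "c * U $$ (i, j) \<in> range of_gauss" if ij: "i < m" "j < n" for i j
    proof -
      have "c * U $$ (i, j) \<in> elements_mat (c \<cdot>\<^sub>m U)"
        by (rule elements_matI[OF C ij]) (use ij assms in simp)
      thus ?thesis using int unfolding gauss_int_mat_def by (rule rev_subsetD)
    qed
    thus "\<forall>i<m. \<forall>j<n. c * U $$ (i, j) \<in> range of_gauss" by blast
  next
    assume int: "\<forall>i<m. \<forall>j<n. c * U $$ (i, j) \<in> range of_gauss"
    show "gauss_int_mat (c \<cdot>\<^sub>m U)"
      unfolding gauss_int_mat_def
    proof
      fix a assume "a \<in> elements_mat (c \<cdot>\<^sub>m U)"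
      then obtain i j where "i < m" "j < n" "a = c * U $$ (i, j)"
        using assms by (auto dest!: elements_matD)
      thus "a \<in> range of_gauss" using int by simp
    qed
  qed
qed

lemma rational_common_denominator:
  assumes "finite S" "\<forall>z \<in> S. Re z \<in> \<rat> \<and> Im z \<in> \<rat>"
  shows "\<exists>k. k \<noteq> 0 \<and> (\<forall>z \<in> S. of_gauss k * z \<in> range of_gauss)"
  using assms
proof (induction S rule: finite_induct)
  case empty
  show ?case by (rule exI[of _ 1]) simp
next
  case (insert z S)
  then obtain k where k: "k \<noteq> 0" "\<forall>z \<in> S. of_gauss k * z \<in> range of_gauss" by auto
  from insert.prems obtain a b where ab: "b > 0" "Re z = of_int a / of_int b"
    by (auto elim!: Rats_cases')
  from insert.prems obtain a' b' where ab': "b' > 0" "Im z = of_int a' / of_int b'"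
    by (auto elim!: Rats_cases')
  define q where "q = Gauss_Int (b * b') 0"
  have q: "q \<noteq> 0" using ab ab' by (simp add: q_def gauss_int_eq_iff)
  have qz: "of_gauss q * z = of_gauss (Gauss_Int (a * b') (a' * b))"
    using ab ab' by (simp add: q_def of_gauss_def complex_eq_iff)
  have "of_gauss (k * q) * x \<in> range of_gauss" if x: "x \<in> insert z S" for x
  proof (cases "x = z")
    case True
    have "of_gauss (k * q) * z = of_gauss (k * Gauss_Int (a * b') (a' * b))"
      by (simp add: of_gauss.hom_mult mult.assoc qz)
    thus ?thesis using True by simp
  next
    case False
    then obtain y where "of_gauss k * x = of_gauss y" using k x by auto
    hence "of_gauss (k * q) * x = of_gauss (q * y)"
      by (simp add: of_gauss.hom_mult mult.left_commute mult.assoc)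
    thus ?thesis by simp
  qed
  thus ?case using k q by (intro exI[of _ "k * q"]) auto
qed

lemma gauss_associate_in_quadrant:
  assumes "z \<noteq> 0"
  shows "\<exists>l \<in> gauss_quadrant. l dvd z \<and> z dvd l"
proof -
  have assoc: "\<exists>l \<in> gauss_quadrant. l dvd z \<and> z dvd l"
    if "u * v = 1" "u * z \<in> gauss_quadrant" for u v
  proof -
    have "z = u * z * v" using that(1) by (simp add: mult.commute mult.left_commute)
    hence "u * z dvd z" by (metis dvd_triv_left)
    thus ?thesis using that(2) by (metis dvd_triv_right)
  qed
  consider "ReZ z > 0" "ImZ z \<ge> 0" | "ReZ z \<le> 0" "ImZ z > 0"
    | "ReZ z < 0" "ImZ z \<le> 0" | "ReZ z \<ge> 0" "ImZ z < 0"
    using assms by (force simp: gauss_int_eq_iff)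
  thus ?thesis
  proof cases
    case 1
    show ?thesis by (rule assoc[of 1 1]) (use 1 in \<open>simp_all add: gauss_quadrant_def\<close>)
  next
    case 2
    show ?thesis by (rule assoc[of "- gauss_i" gauss_i])
      (use 2 in \<open>simp_all add: gauss_quadrant_def gauss_int_eq_iff\<close>)
  next
    case 3
    show ?thesis by (rule assoc[of "- 1" "- 1"]) (use 3 in \<open>simp_all add: gauss_quadrant_def\<close>)
  next
    case 4
    show ?thesis by (rule assoc[of gauss_i "- gauss_i"])
      (use 4 in \<open>simp_all add: gauss_quadrant_def gauss_int_eq_iff\<close>)
  qed
qed

lemma gauss_quadrant_unique:
  assumes "l \<in> gauss_quadrant" "m \<in> gauss_quadrant" "l dvd m" "gauss_norm m \<le> gauss_norm l"
  shows "l = m"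
proof -
  obtain u where u: "m = l * u" using assms(3) by (rule dvdE)
  have l0: "l \<noteq> 0" "u \<noteq> 0" using assms(1,2) by (auto simp: gauss_quadrant_def u)
  hence "gauss_norm u \<le> 1" "gauss_norm u > 0"
    using assms(4) by (auto simp: u gauss_norm_mult)
  hence n1: "(ReZ u)\<^sup>2 + (ImZ u)\<^sup>2 = 1" by (simp add: gauss_norm_def)
  hence "(ReZ u)\<^sup>2 \<le> 1" "(ImZ u)\<^sup>2 \<le> 1"
    using zero_le_power2[of "ReZ u"] zero_le_power2[of "ImZ u"] by linarith+
  hence "\<bar>ReZ u\<bar> \<le> 1" "\<bar>ImZ u\<bar> \<le> 1" by (simp_all add: abs_square_le_1)
  hence "ReZ u \<in> {-1, 0, 1}" "ImZ u \<in> {-1, 0, 1}" by auto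
  with n1 assms(1,2) have "ReZ u = 1 \<and> ImZ u = 0"
    by (auto simp: u gauss_quadrant_def)
  hence "u = 1" by (simp add: gauss_int_eq_iff)
  thus ?thesis by (simp add: u)
qed

text \<open>The Gaussian integers that clear all denominators form a nonzero ideal. Its generator in
  the quadrant is the only solution of the minimization in \<open>level\<close>, so minimal norm
  becomes divisibility.\<close>

lemma level_generates_denominators:
  assumes U: "U \<in> carrier_mat m n" and rat: "gauss_rat_mat U"
  shows "level U \<in> gauss_quadrant" "gauss_int_mat (of_gauss (level U) \<cdot>\<^sub>m U)"
    "gauss_int_mat (of_gauss k \<cdot>\<^sub>m U) \<Longrightarrow> level U dvd k"
proof -
  define I where "I = {k. gauss_int_mat (of_gauss k \<cdot>\<^sub>m U)}"
  have I: "k \<in> I \<longleftrightarrow> (\<forall>i<m. \<forall>j<n. of_gauss k * U $$ (i, j) \<in> range of_gauss)" for k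
    unfolding I_def using gauss_int_mat_smult_iff[OF U] by simp
  have fin: "finite (elements_mat U)" by (simp add: elements_mat_def)
  obtain k0 where k0: "k0 \<noteq> 0" "\<forall>z \<in> elements_mat U. of_gauss k0 * z \<in> range of_gauss"
    using rational_common_denominator[OF fin rat[unfolded gauss_rat_mat_def]] by blast
  have "k0 \<in> I" unfolding I using k0(2) elements_matI[OF U _ _ refl] by blast
  have diff: "x - y \<in> I" if "x \<in> I" "y \<in> I" for x y
  proof -
    have "of_gauss (x - y) * U $$ (i, j) \<in> range of_gauss" if ij: "i < m" "j < n" for i j
    proof -
      obtain a b where "of_gauss x * U $$ (i, j) = of_gauss a" "of_gauss y * U $$ (i, j) = of_gauss b"
        using \<open>x \<in> I\<close> \<open>y \<in> I\<close> ij unfolding I by blast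
      hence "of_gauss (x - y) * U $$ (i, j) = of_gauss (a - b)"
        by (simp add: of_gauss.hom_minus left_diff_distrib)
      thus ?thesis by simp
    qed
    thus ?thesis unfolding I by blast
  qed
  have mult: "r * x \<in> I" if "x \<in> I" for r x
  proof -
    have "of_gauss (r * x) * U $$ (i, j) \<in> range of_gauss" if ij: "i < m" "j < n" for i j
    proof -
      obtain a where "of_gauss x * U $$ (i, j) = of_gauss a"
        using \<open>x \<in> I\<close> ij unfolding I by blast
      hence "of_gauss (r * x) * U $$ (i, j) = of_gauss (r * a)"
        by (simp add: of_gauss.hom_mult mult.assoc)
      thus ?thesis by simp
    qed
    thus ?thesis unfolding I by blast
  qed
  obtain g where g: "g \<in> I" "g \<noteq> 0" "\<forall>x \<in> I. g dvd x"
    using gauss_ideal_generator[OF \<open>k0 \<in> I\<close> k0(1) diff mult] by blast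
  obtain l where l: "l \<in> gauss_quadrant" "l dvd g" "g dvd l"
    using gauss_associate_in_quadrant[OF g(2)] by blast
  have lI: "l \<in> I" using l(3) g(1) mult by (auto elim!: dvdE simp: mult.commute)
  have ldvd: "l dvd k" if "k \<in> I" for k using g(3) that l(2) dvd_trans by blast
  have "level U = l"
    unfolding level_def
  proof (rule the_equality)
    have "gauss_norm l \<le> gauss_norm k" if k: "k \<in> gauss_quadrant" "k \<in> I" for k
    proof -
      obtain u where u: "k = l * u" using ldvd[OF k(2)] by (rule dvdE)
      have "u \<noteq> 0" using k(1) by (auto simp: gauss_quadrant_def u)
      hence "gauss_norm u \<ge> 1" using gauss_norm_pos_iff[of u] by linarith
      thus ?thesis
        using mult_left_mono[of 1 "gauss_norm u" "gauss_norm l"] by (simp add: u gauss_norm_mult)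
    qed
    thus "l \<in> gauss_quadrant \<and> gauss_int_mat (of_gauss l \<cdot>\<^sub>m U) \<and>
        (\<forall>m \<in> gauss_quadrant. gauss_int_mat (of_gauss m \<cdot>\<^sub>m U) \<longrightarrow> gauss_norm l \<le> gauss_norm m)"
      using l(1) lI by (simp add: I_def)
  next
    fix l' assume l': "l' \<in> gauss_quadrant \<and> gauss_int_mat (of_gauss l' \<cdot>\<^sub>m U) \<and>
        (\<forall>m \<in> gauss_quadrant. gauss_int_mat (of_gauss m \<cdot>\<^sub>m U) \<longrightarrow> gauss_norm l' \<le> gauss_norm m)"
    have "l = l'"
      by (rule gauss_quadrant_unique) (use l(1) l' lI ldvd in \<open>auto simp: I_def\<close>)
    thus "l' = l" ..
  qed
  thus "level U \<in> gauss_quadrant" "gauss_int_mat (of_gauss (level U) \<cdot>\<^sub>m U)"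
    "gauss_int_mat (of_gauss k \<cdot>\<^sub>m U) \<Longrightarrow> level U dvd k"
    using l(1) lI ldvd by (auto simp: I_def)
qed

section \<open>Self-converse mixed graphs\<close>

text \<open>Entries are kept in Z[i], since divisibility is trivial over the complex
  numbers.\<close>

definition gauss_adj :: "mixed_graph \<Rightarrow> nat \<Rightarrow> nat \<Rightarrow> gauss_int" where
  "gauss_adj G u v =
     (if {u, v} \<in> edges G then 1
      else if (u, v) \<in> arcs G then gauss_i
      else if (v, u) \<in> arcs G then - gauss_i
      else 0)"

lemma of_gauss_i: "of_gauss gauss_i = \<i>"
  by (simp add: of_gauss_def complex_eq_iff)

lemma hermitian_adj_eq: "hermitian_adj n G = mat n n (\<lambda>(u, v). of_gauss (gauss_adj G u v))"
  unfolding hermitian_adj_def gauss_adj_def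
  by (rule eq_matI) (simp_all add: of_gauss_i of_gauss.hom_uminus)

lemma self_converse_walk_lattice:
  assumes "G \<in> self_converse_graphs n"
  shows "\<exists>f. hermitian_walk_lattice n (gauss_adj G) f"
proof -
  have G: "G \<in> mixed_graphs n" and iso: "mixed_graph_iso n (converse_graph G) G"
    using assms by (auto simp: self_converse_graphs_def)
  obtain f0 where bij: "bij_betw f0 {..<n} {..<n}"
    and e: "\<And>u v. u < n \<Longrightarrow> v < n \<Longrightarrow> {u, v} \<in> edges G \<longleftrightarrow> {f0 u, f0 v} \<in> edges G"
    and a: "\<And>u v. u < n \<Longrightarrow> v < n \<Longrightarrow> (v, u) \<in> arcs G \<longleftrightarrow> (f0 u, f0 v) \<in> arcs G"
    using iso unfolding mixed_graph_iso_def converse_graph_def by auto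
  \<comment> \<open>\<open>permutes\<close> asks for the identity outside the vertex set.\<close>
  define f where "f = (\<lambda>u. if u < n then f0 u else u)"
  have edges: "{u, u} \<notin> edges G" and irr: "(u, u) \<notin> arcs G"
    and anti: "(u, v) \<in> arcs G \<Longrightarrow> (v, u) \<notin> arcs G" for u v
    using G unfolding mixed_graphs_def by (fastforce simp: doubleton_eq_iff)+
  have "hermitian_walk_lattice n (gauss_adj G) f"
  proof
    have "bij_betw f {..<n} {..<n}"
      using bij by (rule bij_betw_cong[THEN iffD1, rotated]) (simp add: f_def)
    thus "f permutes {..<n}" by (rule bij_imp_permutes) (simp add: f_def)
    show "gauss_adj G v u = gauss_adj G (f u) (f v)" if "u < n" "v < n" for u v
      using that e[of v u] e[of u v] a[of u v] a[of v u]
      by (simp add: gauss_adj_def f_def insert_commute)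
    show "gauss_cnj (gauss_adj G u v) = gauss_adj G v u" for u v
      using anti[of u v] by (auto simp: gauss_adj_def gauss_int_eq_iff insert_commute)
    show "gauss_adj G u u = 0" for u using edges irr by (simp add: gauss_adj_def)
  qed
  thus ?thesis by blast
qed

lemma (in hermitian_walk_lattice) det_walk_matrix:
  assumes "A = gauss_adj G"
  shows "det (walk_matrix n G) = of_gauss walk_det"
proof -
  have pow: "hermitian_adj n G ^\<^sub>m k *\<^sub>v vec n (\<lambda>u. of_gauss (x u)) =
      vec n (\<lambda>u. of_gauss ((app ^^ k) x u))" for k x
  proof (induction k arbitrary: x)
    case (Suc k)
    have C: "hermitian_adj n G \<in> carrier_mat n n" by (simp add: hermitian_adj_def)
    have "hermitian_adj n G *\<^sub>v vec n (\<lambda>u. of_gauss (x u)) = vec n (\<lambda>u. of_gauss (app x u))"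
      by (rule eq_vecI)
        (auto simp: hermitian_adj_eq scalar_prod_def app_def assms[symmetric] of_gauss.hom_sum
          of_gauss.hom_mult lessThan_atLeast0)
    moreover have "hermitian_adj n G ^\<^sub>m Suc k *\<^sub>v vec n (\<lambda>u. of_gauss (x u)) =
        hermitian_adj n G ^\<^sub>m k *\<^sub>v (hermitian_adj n G *\<^sub>v vec n (\<lambda>u. of_gauss (x u)))"
      using assoc_mult_mat_vec[OF pow_carrier_mat[OF C, of k] C] by simp
    ultimately show ?case by (simp add: Suc.IH funpow_swap1)
  qed (simp add: hermitian_adj_def)
  have "all_one n = vec n (\<lambda>u. of_gauss 1)" by (auto simp: all_one_def of_gauss.hom_one)
  hence w: "hermitian_adj n G ^\<^sub>m k *\<^sub>v all_one n = vec n (\<lambda>u. of_gauss (walk k u))" for k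
    using pow[of k "\<lambda>_. 1"] by (simp add: walk_def)
  have "walk_matrix n G = map_mat of_gauss (mat n n (\<lambda>(u, k). walk k u))"
    unfolding walk_matrix_def w
    by (rule eq_matI) (auto simp: mat_of_cols_def)
  thus ?thesis by (simp add: walk_det_def fdet_def)
qed

section \<open>Unitary matrices intertwining two Hermitian adjacency matrices\<close>

lemma mat_adjoint_index:
  fixes U :: "complex mat"
  assumes "U \<in> carrier_mat n n" "i < n" "j < n"
  shows "mat_adjoint U $$ (i, j) = cnj (U $$ (j, i))"
  using assms by (simp add: mat_adjoint_def mat_of_rows_def)

lemma mat_adjoint_carrier: "U \<in> carrier_mat n n \<Longrightarrow> mat_adjoint U \<in> carrier_mat n n"
  by (auto simp: mat_adjoint_def)

lemma index_mult_mat_sum: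
  assumes "X \<in> carrier_mat n n" "Y \<in> carrier_mat n n" "i < n" "j < n"
  shows "(X * Y) $$ (i, j) = (\<Sum>k<n. X $$ (i, k) * Y $$ (k, j))"
  using assms by (auto simp: scalar_prod_def lessThan_atLeast0 intro!: sum.cong)

text \<open>
  Both columns below have the same pairings with the walk vectors of \<open>G\<close>, because conjugation acts
  on the walk vectors of \<open>G\<close> and \<open>H\<close> through the permutations \<open>f\<close> and \<open>h\<close>.
\<close>

lemma unitary_cnj_permuted:
  fixes U :: "nat \<Rightarrow> nat \<Rightarrow> complex"
  assumes LG: "hermitian_walk_lattice n A f" and LH: "hermitian_walk_lattice n B h"
    and det: "walk_lattice.walk_det n A \<noteq> 0"
    and inter: "\<And>u j. u < n \<Longrightarrow> j < n \<Longrightarrow>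
      (\<Sum>v<n. of_gauss (A u v) * U v j) = (\<Sum>i<n. U u i * of_gauss (B i j))"
    and sums: "\<And>j. j < n \<Longrightarrow> (\<Sum>u<n. cnj (U u j)) = 1"
    and uj: "u < n" "j < n"
  shows "U u j = cnj (U (f u) (h j))"
proof -
  interpret G: hermitian_walk_lattice n A f by fact
  interpret H: hermitian_walk_lattice n B h by fact
  \<comment> \<open>The adjoint of \<open>U\<close> intertwines \<open>A\<close> and
    \<open>B\<close> and fixes e, so it maps the walk vectors of \<open>A\<close> to those of
    \<open>B\<close>.\<close>
  have walks: "(\<Sum>w<n. cnj (U w j) * of_gauss (G.walk k w)) = of_gauss (H.walk k j)"
    if "j < n" for k j
    using that
  proof (induction k arbitrary: j)
    case 0
    thus ?case using sums by (simp add: of_gauss.hom_one)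
  next
    case (Suc k)
    have adj: "(\<Sum>w<n. cnj (U w j) * of_gauss (A w v)) =
        (\<Sum>i<n. of_gauss (B j i) * cnj (U v i))" if v: "v < n" for v
    proof -
      have "(\<Sum>w<n. cnj (U w j) * of_gauss (A w v)) = cnj (\<Sum>w<n. of_gauss (A v w) * U w j)"
        using v by (simp add: of_gauss_cnj[symmetric] G.hermitian mult.commute)
      also have "\<dots> = cnj (\<Sum>i<n. U v i * of_gauss (B i j))"
        using inter[OF v Suc.prems] by simp
      also have "\<dots> = (\<Sum>i<n. of_gauss (B j i) * cnj (U v i))"
        using Suc.prems by (simp add: of_gauss_cnj[symmetric] H.hermitian mult.commute)
      finally show ?thesis .
    qed
    have "(\<Sum>w<n. cnj (U w j) * of_gauss (G.walk (Suc k) w)) =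
        (\<Sum>w<n. cnj (U w j) * (\<Sum>v<n. of_gauss (A w v) * of_gauss (G.walk k v)))"
      by (simp add: G.app_def of_gauss.hom_sum of_gauss.hom_mult)
    also have "\<dots> = (\<Sum>v<n. (\<Sum>w<n. cnj (U w j) * of_gauss (A w v)) * of_gauss (G.walk k v))"
      by (rule sum_sum_swap_mult)
    also have "\<dots> = (\<Sum>v<n. (\<Sum>i<n. of_gauss (B j i) * cnj (U v i)) * of_gauss (G.walk k v))"
      by (simp add: adj)
    also have "\<dots> = (\<Sum>i<n. of_gauss (B j i) * (\<Sum>v<n. cnj (U v i) * of_gauss (G.walk k v)))"
      by (rule sum_sum_swap_mult[symmetric])
    also have "\<dots> = of_gauss (H.walk (Suc k) j)"
      by (simp add: Suc.IH H.app_def of_gauss.hom_sum of_gauss.hom_mult)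
    finally show ?case .
  qed
  define y where "y = (\<lambda>u. U u j - cnj (U (f u) (h j)))"
  have "(\<Sum>u<n. of_gauss (G.walk k (f u)) * y u) = 0" for k
  proof -
    have "(\<Sum>u<n. U u j * of_gauss (G.walk k (f u))) =
        cnj (\<Sum>u<n. cnj (U u j) * of_gauss (G.walk k u))"
      by (simp add: of_gauss_cnj[symmetric] G.cnj_walk)
    also have "\<dots> = of_gauss (H.walk k (h j))"
      using uj(2) by (simp add: walks of_gauss_cnj[symmetric] H.cnj_walk)
    also have "\<dots> = (\<Sum>w<n. cnj (U w (h j)) * of_gauss (G.walk k w))"
      using uj(2) by (simp add: walks)
    also have "\<dots> = (\<Sum>u<n. cnj (U (f u) (h j)) * of_gauss (G.walk k (f u)))"
      by (rule G.sum_perm[symmetric])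
    finally show ?thesis
      by (simp add: y_def right_diff_distrib sum_subtractf mult.commute)
  qed
  note orth = this
  have "fdet n (\<lambda>k u. of_gauss (G.walk k (f u))) \<noteq> 0"
  proof -
    have "mat n n (\<lambda>(k, u). of_gauss (G.walk k (f u))) =
        map_mat of_gauss (mat n n (\<lambda>(k, u). G.walk k (f u)))" by (rule eq_matI) auto
    hence "fdet n (\<lambda>k u. of_gauss (G.walk k (f u))) = of_gauss (fdet n (\<lambda>k u. G.walk k (f u)))"
      by (simp add: fdet_def)
    also have "fdet n (\<lambda>k u. G.walk k (f u)) = fdet n (\<lambda>u k. G.walk k (f u))"
      using fdet_transpose[of n "\<lambda>u k. G.walk k (f u)"] by simp
    finally show ?thesis
      using fdet_permute_rows[OF G.perm, of "\<lambda>u k. G.walk k u"] det by (auto simp: G.walk_det_def)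
  qed
  from fdet_nonzero_kernel_trivial[OF this, of y u] orth uj(1) have "y u = 0" by blast
  thus ?thesis by (simp add: y_def)
qed

text \<open>
  The hypotheses say that \<open>V = l U\<close> for a matrix \<open>U\<close> with \<open>A U = U B\<close> and \<open>e\<^sup>T U = e\<^sup>T\<close>
  which preserves the bilinear form up to a permutation.
\<close>

lemma (in walk_lattice) scaled_columns:
  assumes inter: "\<And>u j. u < n \<Longrightarrow> j < n \<Longrightarrow> (\<Sum>v<n. A u v * V v j) = (\<Sum>i<n. V u i * B i j)"
    and sums: "\<And>j. j < n \<Longrightarrow> (\<Sum>u<n. V u j) = l"
    and iso: "\<And>j i. j < n \<Longrightarrow> i < n \<Longrightarrow> l\<^sup>2 dvd (\<Sum>u<n. V u j * V (f u) i)"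
    and j: "j < n"
  shows "l dvd (\<Sum>u<n. (app ^^ k) (\<lambda>u. V u j) u)"
    and "l\<^sup>2 dvd form (\<lambda>u. V u j) ((app ^^ k) (\<lambda>u. V u j))"
proof -
  \<comment> \<open>As A V = V B, the columns of A^k V are combinations of columns of
    \<open>V\<close>, which reduces both claims to \<open>sums\<close> and
    \<open>iso\<close>.\<close>
  have "\<exists>g. \<forall>u<n. (app ^^ k) (\<lambda>u. V u j) u = (\<Sum>i<n. V u i * g i)"
  proof (induction k)
    case 0
    show ?case using j by (intro exI[of _ "\<lambda>i. if i = j then 1 else 0"])
      (simp add: if_distrib[of "\<lambda>t. _ * t"] cong: if_cong)
  next
    case (Suc k)
    then obtain g where g: "\<And>u. u < n \<Longrightarrow> (app ^^ k) (\<lambda>u. V u j) u = (\<Sum>i<n. V u i * g i)"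
      by blast
    have step: "(app ^^ Suc k) (\<lambda>u. V u j) u = (\<Sum>m<n. V u m * (\<Sum>i<n. B m i * g i))" if u: "u < n" for u
    proof -
      have "(app ^^ Suc k) (\<lambda>u. V u j) u = (\<Sum>v<n. A u v * (\<Sum>i<n. V v i * g i))"
        by (simp add: app_def g)
      also have "\<dots> = (\<Sum>i<n. (\<Sum>v<n. A u v * V v i) * g i)" by (rule sum_sum_swap_mult)
      also have "\<dots> = (\<Sum>i<n. (\<Sum>m<n. V u m * B m i) * g i)" by (simp add: inter u)
      also have "\<dots> = (\<Sum>m<n. V u m * (\<Sum>i<n. B m i * g i))" by (rule sum_sum_swap_mult[symmetric])
      finally show ?thesis .
    qed
    show ?case by (intro exI[of _ "\<lambda>m. \<Sum>i<n. B m i * g i"] allI impI) (rule step)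
  qed
  then obtain g where g: "\<And>u. u < n \<Longrightarrow> (app ^^ k) (\<lambda>u. V u j) u = (\<Sum>i<n. V u i * g i)"
    by blast
  have "(\<Sum>u<n. (app ^^ k) (\<lambda>u. V u j) u) = (\<Sum>i<n. (\<Sum>u<n. V u i) * g i)"
    using sum_sum_swap_mult[of "\<lambda>_. 1" V g "{..<n}" "{..<n}"] by (simp add: g)
  thus "l dvd (\<Sum>u<n. (app ^^ k) (\<lambda>u. V u j) u)" by (simp add: sums dvd_sum)
  have "form (\<lambda>u. V u j) ((app ^^ k) (\<lambda>u. V u j)) = (\<Sum>u<n. V u j * (\<Sum>i<n. V (f u) i * g i))"
    by (simp add: form_def g)
  also have "\<dots> = (\<Sum>i<n. (\<Sum>u<n. V u j * V (f u) i) * g i)" by (rule sum_sum_swap_mult)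
  also have "l\<^sup>2 dvd \<dots>" by (intro dvd_sum dvd_mult2 iso j) simp
  finally show "l\<^sup>2 dvd form (\<lambda>u. V u j) ((app ^^ k) (\<lambda>u. V u j))" .
qed

text \<open>Up to units, 1 + i is the only possible prime divisor of \<open>l\<close>, and its
  square, which is \<open>2\<close> up to a unit, does not divide \<open>l\<close>. The quadrant
  contains one associate of each element left.\<close>

lemma gauss_quadrant_level_cases:
  assumes l: "l \<in> gauss_quadrant" and n2: "\<not> 2 dvd l"
    and primes: "\<And>p. prime_elem p \<Longrightarrow> p dvd l \<Longrightarrow> p dvd 2"
  shows "l \<in> {1, 1 + gauss_i}"
proof -
  define \<pi> where "\<pi> = 1 + gauss_i"
  have l0: "l \<noteq> 0" using l by (auto simp: gauss_quadrant_def)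
  have pi_dvd: "\<pi> dvd x" if x: "x dvd l" "\<not> x dvd 1" for x
  proof -
    have "x \<noteq> 0" using x l0 by auto
    then obtain p where p: "prime_elem p" "p dvd x"
      using gauss_prime_divisor_exists[OF _ x(2)] by blast
    have "p dvd 2" by (rule primes[OF p(1) dvd_trans[OF p(2) x(1)]])
    thus ?thesis using dvd_trans[OF prime_elem_dvd_2_imp[OF p(1)] p(2)] by (simp add: \<pi>_def)
  qed
  show ?thesis
  proof (cases "l dvd 1")
    case True
    have "1 = l"
      by (rule gauss_quadrant_unique)
        (use True l in \<open>simp_all add: gauss_quadrant_def gauss_unit_iff gauss_norm_def\<close>)
    thus ?thesis by simp
  next
    case False
    hence "\<pi> dvd l" using pi_dvd[of l] by simp
    then obtain m where m: "l = \<pi> * m" by (rule dvdE)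
    have "m dvd 1"
    proof (rule ccontr)
      assume "\<not> m dvd 1"
      hence "\<pi> dvd m" using pi_dvd[of m] by (simp add: m)
      hence "\<pi>\<^sup>2 dvd l" by (simp add: m power2_eq_square)
      thus False using n2 one_plus_i_square_dvd_iff by (simp add: \<pi>_def)
    qed
    hence "gauss_norm l = gauss_norm \<pi>" by (simp add: m gauss_norm_mult gauss_unit_iff)
    hence "\<pi> = l"
      by (intro gauss_quadrant_unique) (use l in \<open>simp_all add: m \<pi>_def gauss_quadrant_def\<close>)
    thus ?thesis by (simp add: \<pi>_def)
  qed
qed

section \<open>Reduction of the level to the columns of l U\<close>

theorem theorem22:
  fixes n :: nat and G :: mixed_graph
  assumes "G \<in> self_converse_graphs n"
    and "\<exists>d. det (walk_matrix n G) / 2 ^ (n div 2) = of_gauss d \<and> gauss_square_free d"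
  shows "\<forall>U \<in> unitary_class n G. level U \<in> {1, 1 + gauss_i}"
proof
  fix U assume "U \<in> unitary_class n G"
  then obtain H where U: "U \<in> carrier_mat n n" and unit: "mat_adjoint U * U = 1\<^sub>m n"
    and rat: "gauss_rat_mat U" and Ue: "U *\<^sub>v all_one n = all_one n"
    and H: "H \<in> self_converse_graphs n"
    and UAU: "mat_adjoint U * hermitian_adj n G * U = hermitian_adj n H"
    unfolding unitary_class_def unitary_mat_def by blast
  obtain f where f: "hermitian_walk_lattice n (gauss_adj G) f"
    using self_converse_walk_lattice[OF assms(1)] by blast
  obtain h where h: "hermitian_walk_lattice n (gauss_adj H) h"
    using self_converse_walk_lattice[OF H] by blast
  interpret G: hermitian_walk_lattice n "gauss_adj G" f by fact
  interpret H: hermitian_walk_lattice n "gauss_adj H" h by fact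
  obtain d where d: "det (walk_matrix n G) / 2 ^ (n div 2) = of_gauss d" "gauss_square_free d"
    using assms(2) by blast
  have "of_gauss G.walk_det = of_gauss (2 ^ (n div 2) * d)"
    using d(1) of_gauss.hom_numeral[of "num.Bit0 num.One"]
    by (simp add: G.det_walk_matrix[OF refl] of_gauss.hom_mult of_gauss.hom_power field_simps)
  hence det: "G.walk_det = 2 ^ (n div 2) * d" by (rule of_gauss.injectivity)
  have d0: "d \<noteq> 0" using d(2) prime_elem_one_plus_i unfolding gauss_square_free_def by auto
  \<comment> \<open>\<open>d\<close> is real or purely imaginary, so divisibility by 1 + i would
    give divisibility by 2, a unit times the square of 1 + i.\<close>
  have d_odd: "\<not> 1 + gauss_i dvd d"
  proof
    assume dvd: "1 + gauss_i dvd d"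
    have "2 ^ (n div 2) * gauss_cnj d = gauss_cnj G.walk_det"
      by (simp add: det gauss_cnj.hom_mult gauss_cnj.hom_power gauss_cnj.hom_numeral)
    with G.walk_det_cnj have "2 ^ (n div 2) * gauss_cnj d \<in> {2 ^ (n div 2) * d, 2 ^ (n div 2) * (- d)}"
      by (auto simp: det)
    hence "gauss_cnj d \<in> {d, - d}"
      by (auto simp only: insert_iff empty_iff mult_cancel_left power_eq_0_iff gauss_int_two_neq_0)
    hence "ReZ d = 0 \<or> ImZ d = 0" by (auto simp: gauss_int_eq_iff)
    with dvd have "2 dvd d" by (auto simp: one_plus_i_dvd_iff two_dvd_gauss_iff)
    thus False
      using d(2) prime_elem_one_plus_i one_plus_i_square_dvd_iff unfolding gauss_square_free_def by blast
  qed
  have W0: "G.walk_det \<noteq> 0" using det d0 by simp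

  have A: "hermitian_adj n G \<in> carrier_mat n n" and B: "hermitian_adj n H \<in> carrier_mat n n"
    by (simp_all add: hermitian_adj_def)
  have Ad: "mat_adjoint U \<in> carrier_mat n n" using U by (rule mat_adjoint_carrier)
  have unit': "U * mat_adjoint U = 1\<^sub>m n" by (rule mat_mult_left_right_inverse[OF Ad U unit])
  have "U * hermitian_adj n H = U * (mat_adjoint U * (hermitian_adj n G * U))"
    using A U Ad by (simp add: UAU[symmetric] assoc_mult_mat[of _ n n _ n _ n])
  also have "\<dots> = U * mat_adjoint U * (hermitian_adj n G * U)"
    using A U Ad by (simp add: assoc_mult_mat[of _ n n _ n _ n])
  also have "\<dots> = hermitian_adj n G * U"
    using A U by (simp add: unit' left_mult_one_mat[of _ n n])
  finally have AU: "hermitian_adj n G * U = U * hermitian_adj n H" ..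
  define u where "u = (\<lambda>i j. U $$ (i, j))"
  have inter: "(\<Sum>w<n. of_gauss (gauss_adj G v w) * u w j) = (\<Sum>i<n. u v i * of_gauss (gauss_adj H i j))"
    if "v < n" "j < n" for v j
    using arg_cong[OF AU, of "\<lambda>M. M $$ (v, j)"] that index_mult_mat_sum[OF A U that]
      index_mult_mat_sum[OF U B that] by (simp add: u_def hermitian_adj_eq)
  have orth: "(\<Sum>v<n. cnj (u v j) * u v i) = (if j = i then 1 else 0)" if "j < n" "i < n" for i j
    using index_mult_mat_sum[OF Ad U that] that U by (simp add: unit u_def mat_adjoint_index)
  have rows: "(\<Sum>i<n. u v i) = 1" if "v < n" for v
    using arg_cong[OF Ue, of "\<lambda>x. x $ v"] that U
    by (simp add: u_def all_one_def scalar_prod_def lessThan_atLeast0)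
  \<comment> \<open>Applying the adjoint of \<open>U\<close> to U e = e shows that the adjoint fixes
    e too.\<close>
  have cols: "(\<Sum>v<n. cnj (u v j)) = 1" if "j < n" for j
  proof -
    have "(\<Sum>v<n. cnj (u v j)) = (\<Sum>v<n. cnj (u v j) * (\<Sum>i<n. u v i * 1))" by (simp add: rows)
    also have "\<dots> = (\<Sum>i<n. (\<Sum>v<n. cnj (u v j) * u v i) * 1)" by (rule sum_sum_swap_mult)
    also have "\<dots> = 1" using that by (simp add: orth)
    finally show ?thesis .
  qed
  have perm: "u v j = cnj (u (f v) (h j))" if "v < n" "j < n" for v j
    by (rule unitary_cnj_permuted[OF f h W0 inter cols that])
  have perm': "u (f v) (h j) = cnj (u v j)" if "v < n" "j < n" for v j
    using perm[OF that] by simp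

  define l where "l = level U"
  note level = level_generates_denominators[OF U rat, folded l_def]
  have l0: "l \<noteq> 0" using level(1) by (auto simp: gauss_quadrant_def)
  have "\<forall>v j. \<exists>z. v < n \<longrightarrow> j < n \<longrightarrow> of_gauss l * u v j = of_gauss z"
    using level(2) unfolding gauss_int_mat_smult_iff[OF U] u_def by blast
  then obtain V where V: "\<And>v j. v < n \<Longrightarrow> j < n \<Longrightarrow> of_gauss (V v j) = of_gauss l * u v j"
    by metis
  have V_inter: "(\<Sum>w<n. gauss_adj G v w * V w j) = (\<Sum>i<n. V v i * gauss_adj H i j)"
    if "v < n" "j < n" for v j
  proof (rule of_gauss.injectivity)
    have "of_gauss (\<Sum>w<n. gauss_adj G v w * V w j) =
        of_gauss l * (\<Sum>w<n. of_gauss (gauss_adj G v w) * u w j)"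
      using that by (simp add: of_gauss.hom_sum of_gauss.hom_mult V sum_distrib_left mult.left_commute)
    also have "\<dots> = of_gauss (\<Sum>i<n. V v i * gauss_adj H i j)"
      using that by (simp add: inter of_gauss.hom_sum of_gauss.hom_mult V sum_distrib_left mult.assoc)
    finally show "of_gauss (\<Sum>w<n. gauss_adj G v w * V w j) = of_gauss (\<Sum>i<n. V v i * gauss_adj H i j)" .
  qed
  have V_sums: "(\<Sum>v<n. V v j) = l" if "j < n" for j
  proof (rule of_gauss.injectivity)
    have "(\<Sum>v<n. u v j) = 1" using arg_cong[OF cols[OF that], of cnj] by simp
    thus "of_gauss (\<Sum>v<n. V v j) = of_gauss l"
      using that by (simp add: of_gauss.hom_sum V sum_distrib_left[symmetric])
  qed
  \<comment> \<open>By \<open>perm'\<close>, permuting the rows of \<open>U\<close> by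
    \<open>f\<close> and the columns by \<open>h\<close> conjugates it, so unitarity makes these
    pairings \<open>l\<^sup>2\<close> times the entries of a permutation matrix.\<close>
  have V_iso: "l\<^sup>2 dvd (\<Sum>v<n. V v j * V (f v) i)" if j: "j < n" and i: "i < n" for i j
  proof -
    obtain k where k: "k < n" "i = h k" using H.perm_surj[OF i] by blast
    have "of_gauss (\<Sum>v<n. V v j * V (f v) i) = (of_gauss l)\<^sup>2 * (\<Sum>v<n. u v j * u (f v) (h k))"
      using j i k
      by (simp add: of_gauss.hom_sum of_gauss.hom_mult V sum_distrib_left power2_eq_square ac_simps)
    also have "(\<Sum>v<n. u v j * u (f v) (h k)) = (\<Sum>v<n. cnj (u v k) * u v j)"
      using k by (simp add: perm' mult.commute)
    also have "\<dots> = of_gauss (if k = j then 1 else 0)"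
      using k j by (simp add: orth of_gauss.hom_one of_gauss.hom_zero)
    finally have "of_gauss (\<Sum>v<n. V v j * V (f v) i) = of_gauss (l\<^sup>2 * (if k = j then 1 else 0))"
      by (simp only: of_gauss.hom_mult of_gauss.hom_power)
    hence "(\<Sum>v<n. V v j * V (f v) i) = l\<^sup>2 * (if k = j then 1 else 0)"
      by (rule of_gauss.injectivity)
    thus ?thesis by (metis dvd_triv_left)
  qed
  have V_cols: "l dvd (\<Sum>u<n. (G.app ^^ k) (\<lambda>v. V v j) u)"
      "l\<^sup>2 dvd G.form (\<lambda>v. V v j) ((G.app ^^ k) (\<lambda>v. V v j))" if "j < n" for j k
    by (rule G.scaled_columns[of V "gauss_adj H"]; use V_inter V_sums V_iso that in simp)+
  \<comment> \<open>Otherwise \<open>l / p\<close> would clear all denominators as well, and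
    \<open>l\<close> would divide it.\<close>
  have primitive: False
    if p: "prime_elem p" "p dvd l" and pV: "\<And>v j. v < n \<Longrightarrow> j < n \<Longrightarrow> p dvd V v j" for p
  proof -
    obtain k where k: "l = p * k" using p(2) by (rule dvdE)
    have p0: "p \<noteq> 0" using p(1) by auto
    have "of_gauss k * U $$ (v, j) \<in> range of_gauss" if vj: "v < n" "j < n" for v j
    proof -
      obtain z where z: "V v j = p * z" using pV[OF vj] by (rule dvdE)
      have "of_gauss p * (of_gauss k * U $$ (v, j)) = of_gauss p * of_gauss z"
        using V[OF vj] unfolding z k u_def of_gauss.hom_mult mult.assoc by (rule sym)
      hence "of_gauss k * U $$ (v, j) = of_gauss z" using p0 by simp
      thus ?thesis by simp
    qed
    hence "gauss_int_mat (of_gauss k \<cdot>\<^sub>m U)" unfolding gauss_int_mat_smult_iff[OF U] by blast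
    hence "l dvd k" by (rule level(3))
    then obtain r where "k = p * k * r" unfolding k by (rule dvdE)
    hence "k * (p * r) = k * 1" by (simp add: ac_simps)
    hence "p * r = 1" using l0 k by simp
    thus False using p(1) by (metis dvd_triv_left prime_elem_def)
  qed

  show "level U \<in> {1, 1 + gauss_i}"
    unfolding l_def[symmetric]
  proof (rule gauss_quadrant_level_cases[OF level(1)])
    show "\<not> 2 dvd l"
    proof
      assume l2: "2 dvd l"
      have l4: "4 dvd l\<^sup>2" using mult_dvd_mono[OF l2 l2] by (simp add: power2_eq_square)
      have "1 + gauss_i dvd V v j" if "v < n" "j < n" for v j
      proof (rule G.one_plus_i_dvd_isotropic_vector[OF det d_odd _ _ that(1), of "\<lambda>v. V v j"])
        show "2 dvd (\<Sum>u<n. (G.app ^^ k) (\<lambda>v. V v j) u)" for k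
          by (rule dvd_trans[OF l2 V_cols(1)[OF that(2)]])
        show "4 dvd G.form (\<lambda>v. V v j) ((G.app ^^ k) (\<lambda>v. V v j))" for k
          by (rule dvd_trans[OF l4 V_cols(2)[OF that(2)]])
      qed
      moreover have "1 + gauss_i dvd l" by (rule dvd_trans[OF one_plus_i_dvd_2 l2])
      ultimately show False using primitive[OF prime_elem_one_plus_i] by blast
    qed
    fix p assume p: "prime_elem p" "p dvd l"
    show "p dvd 2"
    proof (rule ccontr)
      assume p2: "\<not> p dvd 2"
      \<comment> \<open>Away from 2, square-freeness passes from \<open>d\<close> to the walk
        determinant.\<close>
      have "\<not> p dvd 2 ^ (n div 2)" using prime_elem_dvd_power[OF p(1)] p2 by blast
      hence nd: "\<not> p\<^sup>2 dvd G.walk_det"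
        using prime_elem_square_dvd_multD[OF p(1)] d(2) p(1) unfolding det gauss_square_free_def by blast
      have p2l: "p\<^sup>2 dvd l\<^sup>2" using p(2) by (simp add: power2_eq_square mult_dvd_mono)
      have "p dvd V v j" if "v < n" "j < n" for v j
      proof (rule G.prime_dvd_isotropic_vector[OF p(1) nd _ _ _ that(1), of "\<lambda>v. V v j"])
        show "p dvd (\<Sum>u<n. (G.app ^^ k) (\<lambda>v. V v j) u)" for k
          by (rule dvd_trans[OF p(2) V_cols(1)[OF that(2)]])
        show "p\<^sup>2 dvd G.form (\<lambda>v. V v j) (\<lambda>v. V v j)"
          using dvd_trans[OF p2l V_cols(2)[OF that(2), of 0]] by simp
        show "p\<^sup>2 dvd G.form (\<lambda>v. V v j) (G.app (\<lambda>v. V v j))"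
          using dvd_trans[OF p2l V_cols(2)[OF that(2), of 1]] by simp
      qed
      thus False using primitive[OF p] by blast
    qed
  qed
qed

end
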